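(* Let $(X,d)$ be a Polish metric space. Then for every $a,b>0$ and $\mu,\nu\in\mathcal{M}(X)$, $$W_1^{a,b}(\mu,\nu)=\sup\left\{\int_X f\,d(\mu-\nu)\;:\;f\in\mathbb{F}\right\},$$ where $\mathbb{F}:=\{f\in C_b(X)\;:\;\|f\|_\infty\le a,\ \|f\|_{Lip}\le b\}$.
   Context: A Polish metric space is a complete separable metric space. $C_b(X)$ is the space of bounded continuous real functions on $X$, $\|f\|_\infty=\sup_X|f|$, and $\|f\|_{Lip}:=\sup_{x\ne y}\frac{|f(x)-f(y)|}{d(x,y)}$. $\mathcal{M}(X)$ is the set of nonnegative Borel measures on $X$ with finite mass; $\mathcal{M}_1(X)$ is the set of $\mu\in\mathcal{M}(X)$ with $\int_X d(x,x_0)\,d\mu(x)<\infty$ for some (equivalently any) $x_0\in X$. For $\mu\in\mathcal{M}(X)$, $|\mu|:=\mu(X)$, and $|\mu-\nu|$ denotes the total variation mass of the signed measure $\mu-\nu$. For $\mu,\nu\in\mathcal{M}(X)$ with $|\mu|=|\nu|$, $\Pi(\mu,\nu)$ is the set of Borel probability measures $\pi$ on $X\times X$ with $|\mu|\pi(A\times X)=\mu(A)$ and $|\nu|\pi(X\times B)=\nu(B)$ for all Borel $A,B\subset X$; for $\mu,\nu\in\mathcal{M}_1(X)$ with $|\mu|=|\nu|$, $W_1(\mu,\nu):=|\mu|\inf_{\pi\in\Pi(\mu,\nu)}\int_{X\times X}d(x,y)\,d\pi(x,y)$. Generalized Wasserstein distance: for $a,b>0$ and $\mu,\nu\in\mathcal{M}(X)$,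 $$W_1^{a,b}(\mu,\nu):=\inf\{a|\mu-\widetilde\mu|+a|\nu-\widetilde\nu|+b\,W_1(\widetilde\mu,\widetilde\nu)\;:\;\widetilde\mu,\widetilde\nu\in\mathcal{M}_1(X),\ |\widetilde\mu|=|\widetilde\nu|\}.$$ *)

theory Defs
  imports "HOL-Probability.Probability"
begin

text \<open>
  A Polish metric space is a type of class \<^class>\<open>polish_space\<close>: this class asks that the given
  metric itself be complete, and that the topology be second countable (for a metric space this is
  separability).
\<close>

definition finite_borel_measures :: "'a::metric_space measure set" where
  "finite_borel_measures = {\<mu>. sets \<mu> = sets borel \<and> finite_measure \<mu>}"

definition finite_borel_measures1 :: "'a::metric_space measure set" where
  "finite_borel_measures1 =
     {\<mu> \<in> finite_borel_measures. \<exists>x0. (\<integral>\<^sup>+ x. ennreal (dist x x0) \<partial>\<mu>) < \<infinity>}"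

text \<open>
  The signed measure \<open>\<mu> - \<nu>\<close> as a set function. The library's subtraction of measures is
  truncated, so it is not suitable here.
\<close>

definition signed_diff :: "'a measure \<Rightarrow> 'a measure \<Rightarrow> 'a set \<Rightarrow> real" where
  "signed_diff \<mu> \<nu> A = measure \<mu> A - measure \<nu> A"

text \<open>
  The total variation mass of a signed Borel measure, as a supremum over finite Borel partitions
  of the space. For a difference of finite measures the sums are bounded by
  \<open>\<mu>(X) + \<nu>(X)\<close>, so the real-valued supremum is a genuine one.
\<close>

definition total_variation :: "('a::topological_space set \<Rightarrow> real) \<Rightarrow> real" where
  "total_variation \<sigma> =
     (SUP P \<in> {P. finite P \<and> P \<subseteq> sets borel \<and> disjoint P \<and> \<Union>P = UNIV}. \<Sum>A\<in>P. \<bar>\<sigma> A\<bar>)"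

definition couplings :: "'a::metric_space measure \<Rightarrow> 'a measure \<Rightarrow> ('a \<times> 'a) measure set" where
  "couplings \<mu> \<nu> =
     {\<pi>. sets \<pi> = sets borel \<and> prob_space \<pi> \<and>
         (\<forall>A \<in> sets borel. measure \<mu> UNIV * measure \<pi> (A \<times> UNIV) = measure \<mu> A) \<and>
         (\<forall>B \<in> sets borel. measure \<nu> UNIV * measure \<pi> (UNIV \<times> B) = measure \<nu> B)}"

text \<open>
  The transport cost is a nonnegative extended integral, so that a coupling of infinite cost does
  not count as one of cost \<open>0\<close>. For \<open>\<mu>\<close>, \<open>\<nu>\<close> of equal mass with finite first moments the
  infimum is finite, and the conversion to a real number loses nothing.
\<close>

definition wasserstein1 :: "'a::metric_space measure \<Rightarrow> 'a measure \<Rightarrow> real" where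
  "wasserstein1 \<mu> \<nu> =
     measure \<mu> UNIV *
       enn2real (INF \<pi> \<in> couplings \<mu> \<nu>. \<integral>\<^sup>+ p. ennreal (dist (fst p) (snd p)) \<partial>\<pi>)"

definition gen_wasserstein ::
    "real \<Rightarrow> real \<Rightarrow> 'a::metric_space measure \<Rightarrow> 'a measure \<Rightarrow> real" where
  "gen_wasserstein a b \<mu> \<nu> =
     Inf {a * total_variation (signed_diff \<mu> \<mu>') + a * total_variation (signed_diff \<nu> \<nu>')
            + b * wasserstein1 \<mu>' \<nu>' |\<mu>' \<nu>'.
          \<mu>' \<in> finite_borel_measures1 \<and> \<nu>' \<in> finite_borel_measures1 \<and>
          measure \<mu>' UNIV = measure \<nu>' UNIV}"

text \<open>
  The Lipschitz seminorm is extended-valued, because a bounded continuous function need not be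
  Lipschitz; on a one-point space the supremum is over the empty set and equals \<open>0\<close>.
\<close>

definition lip_seminorm :: "('a::metric_space \<Rightarrow> real) \<Rightarrow> ennreal" where
  "lip_seminorm f =
     (SUP (x, y) \<in> {(x, y). x \<noteq> y}. ennreal (\<bar>f x - f y\<bar> / dist x y))"

text \<open>The norm on the type of bounded continuous functions is the supremum norm.\<close>

definition test_functions :: "real \<Rightarrow> real \<Rightarrow> ('a::metric_space \<Rightarrow>\<^sub>C real) set" where
  "test_functions a b = {f. norm f \<le> a \<and> lip_seminorm (apply_bcontfun f) \<le> ennreal b}"

definition integral_signed_diff :: "'a measure \<Rightarrow> 'a measure \<Rightarrow> ('a \<Rightarrow> real) \<Rightarrow> real" where
  "integral_signed_diff \<mu> \<nu> f = (\<integral>x. f x \<partial>\<mu>) - (\<integral>x. f x \<partial>\<nu>)"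

end

theory Submission
  imports Defs
begin

text \<open>
  The inequality \<open>\<ge>\<close> is the decomposition \<open>\<mu> - \<nu> = (\<mu> - \<mu>') + (\<mu>' - \<nu>') + (\<nu>' - \<nu>)\<close>: a test function
  \<open>f\<close> is bounded by \<open>a\<close>, so a Hahn decomposition bounds its integrals against the outer two differences
  by \<open>a\<close> times their total variations (\<open>integral_diff_le_total_variation\<close>), and \<open>f\<close> is
  \<open>b\<close>-Lipschitz, so integration against couplings bounds the middle one by \<open>b\<close> times the
  Wasserstein distance (\<open>wasserstein1_dual_bound\<close>).

  For \<open>\<le>\<close> the problem is discretised. Separability gives a countable partition into Borel cells of
  radius \<open>\<delta>\<close>, and finitely many of them carry all but \<open>\<delta>\<close> of the mass of \<open>\<mu>\<close> and of \<open>\<nu>\<close>. On the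
  masses of these cells there is a finite problem: plans \<open>\<pi> i j \<ge> 0\<close> pay a price per unit moved and \<open>a\<close> per
  unit of mass by which their marginals are wrong. Its optimal value is a sublinear function of the
  masses, so by the Hahn-Banach theorem it is supported by a linear functional, that is, by potentials
  \<open>f\<close>, \<open>g\<close> bounded by \<open>a\<close> with \<open>f i + g j\<close> at most the price (\<open>finite_transport_duality\<close>). Both
  solutions are then carried back to the space. A nearly optimal \<open>\<pi>\<close> becomes a plan with
  piecewise constant density with respect to \<open>\<mu> \<Otimes>\<^sub>M \<nu>\<close>, whose marginals are piecewise constant multiples of
  \<open>\<mu>\<close> and \<open>\<nu>\<close> with bounded support (\<open>cell_plan\<close>, \<open>total_variation_cell_density_le\<close>,
  \<open>cell_density_moment\<close>). The potentials become the single test function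
  \<open>min\<^sub>j (b * dist x (c j) - g j)\<close>, truncated to \<open>[- a, a]\<close> (\<open>lipschitz_potential\<close>). All errors are of
  order \<open>\<delta>\<close> (\<open>almost_optimal_test_function\<close>).
\<close>

section \<open>The Hahn-Banach theorem on a finite-dimensional coordinate space\<close>

definition sublinear :: "(('k \<Rightarrow> real) \<Rightarrow> real) \<Rightarrow> bool" where
  "sublinear p \<longleftrightarrow> (\<forall>u v. p (\<lambda>k. u k + v k) \<le> p u + p v) \<and>
     (\<forall>t u. 0 \<le> t \<longrightarrow> p (\<lambda>k. t * u k) = t * p u)"

lemma sublinear_add: "sublinear p \<Longrightarrow> p (\<lambda>k. u k + v k) \<le> p u + p v"
  by (simp add: sublinear_def)

lemma sublinear_scale: "sublinear p \<Longrightarrow> 0 \<le> t \<Longrightarrow> p (\<lambda>k. t * u k) = t * p u"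
  by (simp add: sublinear_def)

lemma sublinear_zero: "sublinear p \<Longrightarrow> p (\<lambda>k. 0) = 0"
  using sublinear_scale[of p 0 "\<lambda>k. 0"] by simp

lemma sublinear_minus: "sublinear p \<Longrightarrow> - p u \<le> p (\<lambda>k. - u k)"
  using sublinear_add[of p u "\<lambda>k. - u k"] sublinear_zero[of p] by simp

text \<open>
  Homogeneity needs only one inequality: the other one follows by scaling back with the inverse factor.
\<close>

lemma sublinearI:
  assumes add: "\<And>u v. p (\<lambda>k. u k + v k) \<le> p u + p v"
    and zero: "p (\<lambda>k. 0) = 0"
    and scale: "\<And>t u. 0 < t \<Longrightarrow> p (\<lambda>k. t * u k) \<le> t * p u"
  shows "sublinear p"
  unfolding sublinear_def
proof (intro conjI allI impI add)
  fix t :: real and u assume "0 \<le> t"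
  show "p (\<lambda>k. t * u k) = t * p u"
  proof (cases "t = 0")
    case True
    then show ?thesis using zero by simp
  next
    case False
    with \<open>0 \<le> t\<close> have t: "0 < t" by simp
    have "p (\<lambda>k. inverse t * (t * u k)) \<le> inverse t * p (\<lambda>k. t * u k)"
      using t by (intro scale) auto
    also have "(\<lambda>k. inverse t * (t * u k)) = u"
      using t by (auto simp: field_simps)
    finally have "t * p u \<le> p (\<lambda>k. t * u k)"
      using t by (simp add: field_simps)
    with scale[OF t, of u] show ?thesis by simp
  qed
qed

text \<open>
  Among the sublinear minorants \<open>q\<close> of \<open>p\<close> with \<open>q (- v) \<le> - p v\<close> this is the largest: since
  \<open>u = (u + t v) + t (- v)\<close>, every such \<open>q\<close> satisfies \<open>q u \<le> p (u + t v) - t p v\<close> for all \<open>t \<ge> 0\<close>.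
  Because a sublinear functional always satisfies \<open>- q v \<le> q (- v)\<close>, the two inequalities together
  force \<open>q\<close> to be linear along \<open>v\<close> and to agree with \<open>p\<close> at \<open>v\<close>.
\<close>

definition linearize :: "('k \<Rightarrow> real) \<Rightarrow> (('k \<Rightarrow> real) \<Rightarrow> real) \<Rightarrow> ('k \<Rightarrow> real) \<Rightarrow> real" where
  "linearize v p u = (INF t\<in>{0..}. p (\<lambda>k. u k + t * v k) - t * p v)"

text \<open>
  The infimum is over a set that is bounded below by \<open>- p (- u)\<close>, because
  \<open>t p v = p (t v) \<le> p (u + t v) + p (- u)\<close>.
\<close>

lemma linearize_le:
  assumes p: "sublinear p" and t: "0 \<le> t"
  shows "linearize v p u \<le> p (\<lambda>k. u k + t * v k) - t * p v"
proof -
  have "- p (\<lambda>k. - u k) \<le> p (\<lambda>k. u k + s * v k) - s * p v" if "0 \<le> s" for s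
    using sublinear_add[OF p, of "\<lambda>k. u k + s * v k" "\<lambda>k. - u k"] sublinear_scale[OF p that, of v]
    by simp
  then have "bdd_below ((\<lambda>t. p (\<lambda>k. u k + t * v k) - t * p v) ` {0..})"
    by (intro bdd_belowI2[of _ "- p (\<lambda>k. - u k)"]) auto
  then show ?thesis
    unfolding linearize_def using t by (intro cINF_lower) auto
qed

lemma linearize_approx:
  assumes "0 < e"
  shows "\<exists>t\<ge>0. p (\<lambda>k. u k + t * v k) - t * p v < linearize v p u + e"
proof (rule ccontr)
  assume "\<not> ?thesis"
  then have "linearize v p u + e \<le> linearize v p u"
    by (subst (2) linearize_def, intro cINF_greatest) (auto simp: not_less)
  with assms show False by simp
qed

lemma sublinear_linearize:
  assumes p: "sublinear p"
  shows "sublinear (linearize v p)"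
proof (rule sublinearI)
  fix u w
  show "linearize v p (\<lambda>k. u k + w k) \<le> linearize v p u + linearize v p w"
  proof (rule field_le_epsilon)
    fix e :: real assume "0 < e"
    obtain s where s: "0 \<le> s" "p (\<lambda>k. u k + s * v k) - s * p v < linearize v p u + e / 2"
      using linearize_approx[of "e / 2" p u v] \<open>0 < e\<close> by auto
    obtain t where t: "0 \<le> t" "p (\<lambda>k. w k + t * v k) - t * p v < linearize v p w + e / 2"
      using linearize_approx[of "e / 2" p w v] \<open>0 < e\<close> by auto
    have "linearize v p (\<lambda>k. u k + w k) \<le> p (\<lambda>k. u k + w k + (s + t) * v k) - (s + t) * p v"
      using s t by (intro linearize_le p) auto
    also have "(\<lambda>k. u k + w k + (s + t) * v k) = (\<lambda>k. (u k + s * v k) + (w k + t * v k))"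
      by (auto simp: algebra_simps)
    also have "p \<dots> - (s + t) * p v
        \<le> (p (\<lambda>k. u k + s * v k) - s * p v) + (p (\<lambda>k. w k + t * v k) - t * p v)"
      using sublinear_add[OF p, of "\<lambda>k. u k + s * v k" "\<lambda>k. w k + t * v k"]
      by (simp add: algebra_simps)
    finally show "linearize v p (\<lambda>k. u k + w k) \<le> linearize v p u + linearize v p w + e"
      using s t by simp
  qed
next
  show "linearize v p (\<lambda>k. 0) = 0"
  proof (rule antisym)
    show "linearize v p (\<lambda>k. 0) \<le> 0"
      using linearize_le[OF p, of 0 v "\<lambda>k. 0"] sublinear_zero[OF p] by simp
    show "0 \<le> linearize v p (\<lambda>k. 0)"
      unfolding linearize_def
      by (intro cINF_greatest) (auto simp: sublinear_scale[OF p])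
  qed
next
  fix c :: real and u assume c: "0 < c"
  show "linearize v p (\<lambda>k. c * u k) \<le> c * linearize v p u"
  proof (rule field_le_epsilon)
    fix e :: real assume "0 < e"
    obtain t where t: "0 \<le> t" "p (\<lambda>k. u k + t * v k) - t * p v < linearize v p u + e / c"
      using linearize_approx[of "e / c" p u v] \<open>0 < e\<close> c by auto
    have "linearize v p (\<lambda>k. c * u k) \<le> p (\<lambda>k. c * u k + (c * t) * v k) - (c * t) * p v"
      using t c by (intro linearize_le p) auto
    also have "(\<lambda>k. c * u k + (c * t) * v k) = (\<lambda>k. c * (u k + t * v k))"
      by (auto simp: algebra_simps)
    also have "p \<dots> - (c * t) * p v = c * (p (\<lambda>k. u k + t * v k) - t * p v)"
      using c by (simp add: sublinear_scale[OF p] right_diff_distrib mult.assoc)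
    also have "\<dots> \<le> c * (linearize v p u + e / c)"
      using t c by (intro mult_left_mono) auto
    also have "\<dots> = c * linearize v p u + e"
      using c by (simp add: algebra_simps)
    finally show "linearize v p (\<lambda>k. c * u k) \<le> c * linearize v p u + e" .
  qed
qed

lemma linearize_le_self: "sublinear p \<Longrightarrow> linearize v p u \<le> p u"
  using linearize_le[of p 0 v u] by simp

lemma linearize_minus_le: "sublinear p \<Longrightarrow> linearize v p (\<lambda>k. - v k) \<le> - p v"
  using linearize_le[of p 1 v "\<lambda>k. - v k"] sublinear_zero[of p] by simp

text \<open>
  Replacing \<open>p\<close> by \<open>linearize v p\<close> for one direction after another keeps the linearity obtained
  before: if \<open>q (- v) = - q v\<close> and \<open>r \<le> q\<close> is sublinear, then
  \<open>- r v \<le> r (- v) \<le> q (- v) = - q v \<le> - r v\<close>, with the last step from \<open>r v \<le> q v\<close>.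
  The first direction is \<open>u\<^sub>0\<close>, so that the value \<open>p u\<^sub>0\<close> is not lost later.
\<close>

lemma sublinear_linear_at:
  assumes p: "sublinear p" and V: "finite V"
  obtains q where "sublinear q" "\<And>u. q u \<le> p u" "\<And>v. v \<in> V \<Longrightarrow> q (\<lambda>k. - v k) = - q v"
    "q (\<lambda>k. - u\<^sub>0 k) \<le> - p u\<^sub>0"
proof -
  have "\<exists>q. sublinear q \<and> (\<forall>u. q u \<le> p u) \<and> (\<forall>v\<in>V. q (\<lambda>k. - v k) = - q v) \<and>
      q (\<lambda>k. - u\<^sub>0 k) \<le> - p u\<^sub>0"
    using V
  proof induction
    case empty
    show ?case
      using sublinear_linearize[OF p, of u\<^sub>0] linearize_le_self[OF p] linearize_minus_le[OF p, of u\<^sub>0]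
      by auto
  next
    case (insert w V)
    then obtain q where q: "sublinear q" "\<And>u. q u \<le> p u"
      "\<And>v. v \<in> V \<Longrightarrow> q (\<lambda>k. - v k) = - q v" "q (\<lambda>k. - u\<^sub>0 k) \<le> - p u\<^sub>0"
      by blast
    let ?q = "linearize w q"
    have le: "?q u \<le> q u" for u
      using linearize_le_self[OF q(1)] .
    have ge: "- ?q u \<le> ?q (\<lambda>k. - u k)" for u
      using sublinear_minus[OF sublinear_linearize[OF q(1)]] .
    have "?q (\<lambda>k. - v k) = - ?q v" if "v \<in> insert w V" for v
    proof -
      have "?q (\<lambda>k. - v k) \<le> - q v"
      proof (cases "v = w")
        case True
        then show ?thesis using linearize_minus_le[OF q(1), of w] by simp
      next
        case False
        then show ?thesis using that le[of "\<lambda>k. - v k"] q(3) by simp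
      qed
      with le[of v] ge[of v] show ?thesis by simp
    qed
    then show ?case
      using sublinear_linearize[OF q(1), of w] le q(2,4) order_trans by blast
  qed
  with that show thesis by blast
qed

text \<open>
  A sublinear minorant that is linear along every coordinate vector \<open>e k\<close> lies below the linear
  functional with coefficients \<open>f k = q (e k)\<close>. Applied to \<open>- u\<close>, this also gives
  \<open>(\<Sum>k\<in>K. f k * u k) \<le> - q (- u) \<le> q u \<le> p u\<close>.
\<close>

lemma finite_Hahn_Banach:
  fixes p :: "('k \<Rightarrow> real) \<Rightarrow> real"
  assumes p: "sublinear p" and K: "finite K" and u\<^sub>0: "\<And>k. k \<notin> K \<Longrightarrow> u\<^sub>0 k = 0"
  obtains f where "\<And>u. (\<And>k. k \<notin> K \<Longrightarrow> u k = 0) \<Longrightarrow> (\<Sum>k\<in>K. f k * u k) \<le> p u"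
    "p u\<^sub>0 \<le> (\<Sum>k\<in>K. f k * u\<^sub>0 k)"
proof -
  define e :: "'k \<Rightarrow> 'k \<Rightarrow> real" where "e k = (\<lambda>l. if l = k then 1 else 0)" for k
  obtain q where q: "sublinear q" "\<And>u. q u \<le> p u"
    "\<And>v. v \<in> e ` K \<Longrightarrow> q (\<lambda>k. - v k) = - q v" "q (\<lambda>k. - u\<^sub>0 k) \<le> - p u\<^sub>0"
    using sublinear_linear_at[OF p, of "e ` K" u\<^sub>0] K by blast
  have scale: "q (\<lambda>l. t * e k l) = t * q (e k)" if "k \<in> K" for t k
  proof (cases "0 \<le> t")
    case True
    then show ?thesis by (rule sublinear_scale[OF q(1)])
  next
    case False
    have "q (\<lambda>l. (- t) * (- e k l)) = (- t) * q (\<lambda>l. - e k l)"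
      using False by (intro sublinear_scale[OF q(1)]) auto
    then show ?thesis using q(3)[of "e k"] that by simp
  qed
  have upper: "q (\<lambda>l. \<Sum>k\<in>L. u k * e k l) \<le> (\<Sum>k\<in>L. q (e k) * u k)" if "L \<subseteq> K" for L u
    using finite_subset[OF that K] that
  proof (induction)
    case empty
    then show ?case using sublinear_zero[OF q(1)] by simp
  next
    case (insert k L)
    then have "q (\<lambda>l. u k * e k l + (\<Sum>k\<in>L. u k * e k l))
        \<le> q (\<lambda>l. u k * e k l) + q (\<lambda>l. \<Sum>k\<in>L. u k * e k l)"
      by (intro sublinear_add q)
    with insert show ?case by (simp add: scale mult.commute)
  qed
  have expand: "(\<lambda>l. \<Sum>k\<in>K. u k * e k l) = u" if "\<And>k. k \<notin> K \<Longrightarrow> u k = 0" for u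
    using that K by (auto simp: e_def fun_eq_iff if_distrib sum.delta cong: if_cong)
  have upper': "q u \<le> (\<Sum>k\<in>K. q (e k) * u k)" if "\<And>k. k \<notin> K \<Longrightarrow> u k = 0" for u
    using upper[of K u] expand[OF that] by simp
  show thesis
  proof (rule that[of "\<lambda>k. q (e k)"])
    fix u :: "'k \<Rightarrow> real" assume u: "\<And>k. k \<notin> K \<Longrightarrow> u k = 0"
    have "q (\<lambda>k. - u k) \<le> (\<Sum>k\<in>K. q (e k) * - u k)"
      using u by (intro upper') auto
    then show "(\<Sum>k\<in>K. q (e k) * u k) \<le> p u"
      using sublinear_minus[OF q(1), of u] q(2)[of u] by (simp add: sum_negf)
  next
    show "p u\<^sub>0 \<le> (\<Sum>k\<in>K. q (e k) * u\<^sub>0 k)"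
      using upper'[of u\<^sub>0] u\<^sub>0 q(4) sublinear_minus[OF q(1), of u\<^sub>0] by simp
  qed
qed

section \<open>Duality for the finite transport problem with unmatched mass\<close>

text \<open>
  A plan \<open>\<pi>\<close> moves mass \<open>\<pi> i j\<close> from source \<open>i\<close> to target \<open>j\<close> at unit price \<open>c i j\<close>, and every unit by
  which its marginals miss the prescribed masses costs \<open>a\<close>. Source and target masses are the two
  halves of one vector on \<open>'i + 'j\<close>, and entries of either sign are allowed: the value as a function
  of that vector is then sublinear on the whole space.
\<close>

definition plan_cost ::
    "'i set \<Rightarrow> 'j set \<Rightarrow> ('i \<Rightarrow> 'j \<Rightarrow> real) \<Rightarrow> real \<Rightarrow> ('i + 'j \<Rightarrow> real) \<Rightarrow> ('i \<Rightarrow> 'j \<Rightarrow> real) \<Rightarrow> real"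
where
  "plan_cost I J c a u \<pi> =
     a * (\<Sum>i\<in>I. \<bar>u (Inl i) - (\<Sum>j\<in>J. \<pi> i j)\<bar>) + a * (\<Sum>j\<in>J. \<bar>u (Inr j) - (\<Sum>i\<in>I. \<pi> i j)\<bar>)
     + (\<Sum>i\<in>I. \<Sum>j\<in>J. c i j * \<pi> i j)"

lemma weighted_sum_abs_diff_triangle:
  fixes x y s t :: "'k \<Rightarrow> real"
  assumes "0 \<le> a"
  shows "a * (\<Sum>k\<in>K. \<bar>x k + y k - (s k + t k)\<bar>)
    \<le> a * (\<Sum>k\<in>K. \<bar>x k - s k\<bar>) + a * (\<Sum>k\<in>K. \<bar>y k - t k\<bar>)"
  unfolding distrib_left[symmetric] sum.distrib[symmetric]
  using assms by (intro mult_left_mono sum_mono) auto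

lemma plan_cost_add:
  assumes "0 \<le> a"
  shows "plan_cost I J c a (\<lambda>k. u k + v k) (\<lambda>i j. \<pi> i j + \<rho> i j)
    \<le> plan_cost I J c a u \<pi> + plan_cost I J c a v \<rho>"
proof -
  show ?thesis
    unfolding plan_cost_def sum.distrib distrib_left
    using weighted_sum_abs_diff_triangle[OF assms, where K=I and x="\<lambda>i. u (Inl i)" and y="\<lambda>i. v (Inl i)"
        and s="\<lambda>i. \<Sum>j\<in>J. \<pi> i j" and t="\<lambda>i. \<Sum>j\<in>J. \<rho> i j"]
      weighted_sum_abs_diff_triangle[OF assms, where K=J and x="\<lambda>j. u (Inr j)" and y="\<lambda>j. v (Inr j)"
        and s="\<lambda>j. \<Sum>i\<in>I. \<pi> i j" and t="\<lambda>j. \<Sum>i\<in>I. \<rho> i j"]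
    by linarith
qed

lemma plan_cost_scale:
  assumes "0 \<le> t"
  shows "plan_cost I J c a (\<lambda>k. t * u k) (\<lambda>i j. t * \<pi> i j) = t * plan_cost I J c a u \<pi>"
proof -
  have "\<bar>t * x - t * y\<bar> = t * \<bar>x - y\<bar>" for x y
    using assms by (metis abs_mult abs_of_nonneg right_diff_distrib)
  then show ?thesis
    unfolding plan_cost_def sum_distrib_left[symmetric]
    by (simp add: sum_distrib_left[symmetric] distrib_left mult.left_commute[of _ t])
qed

lemma plan_cost_nonneg:
  assumes "0 \<le> a" "\<And>i j. i \<in> I \<Longrightarrow> j \<in> J \<Longrightarrow> 0 \<le> c i j" "\<And>i j. 0 \<le> \<pi> i j"
  shows "0 \<le> plan_cost I J c a u \<pi>"
  unfolding plan_cost_def using assms by (intro add_nonneg_nonneg mult_nonneg_nonneg sum_nonneg) auto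

definition plan_value ::
    "'i set \<Rightarrow> 'j set \<Rightarrow> ('i \<Rightarrow> 'j \<Rightarrow> real) \<Rightarrow> real \<Rightarrow> ('i + 'j \<Rightarrow> real) \<Rightarrow> real"
where
  "plan_value I J c a u = (INF \<pi>\<in>{\<pi>. \<forall>i j. 0 \<le> \<pi> i j}. plan_cost I J c a u \<pi>)"

lemma plan_value_le:
  assumes "0 \<le> a" "\<And>i j. i \<in> I \<Longrightarrow> j \<in> J \<Longrightarrow> 0 \<le> c i j" "\<And>i j. 0 \<le> \<pi> i j"
  shows "plan_value I J c a u \<le> plan_cost I J c a u \<pi>"
  unfolding plan_value_def
  using assms by (intro cINF_lower bdd_belowI2[of _ 0] plan_cost_nonneg) auto

lemma plan_value_approx:
  assumes "0 < e"
  shows "\<exists>\<pi>. (\<forall>i j. 0 \<le> \<pi> i j) \<and> plan_cost I J c a u \<pi> < plan_value I J c a u + e"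
proof (rule ccontr)
  assume "\<not> ?thesis"
  then have *: "plan_value I J c a u + e \<le> plan_cost I J c a u \<pi>" if "\<And>i j. 0 \<le> \<pi> i j" for \<pi>
    using that not_less by blast
  have "plan_value I J c a u + e \<le> plan_value I J c a u"
    by (subst (2) plan_value_def, intro cINF_greatest)
       (auto intro: * exI[of _ "\<lambda>_ _. 0"])
  with assms show False by simp
qed

lemma sublinear_plan_value:
  assumes a: "0 \<le> a" and c: "\<And>i j. i \<in> I \<Longrightarrow> j \<in> J \<Longrightarrow> 0 \<le> c i j"
  shows "sublinear (plan_value I J c a)"
proof (rule sublinearI)
  note le = plan_value_le[of a I J c, OF a c]
  fix u v
  show "plan_value I J c a (\<lambda>k. u k + v k) \<le> plan_value I J c a u + plan_value I J c a v"
  proof (rule field_le_epsilon)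
    fix e :: real assume e: "0 < e"
    obtain \<pi> where \<pi>: "\<And>i j. 0 \<le> \<pi> i j" "plan_cost I J c a u \<pi> < plan_value I J c a u + e/2"
      using plan_value_approx[of "e/2" I J c a u] e by auto
    obtain \<rho> where \<rho>: "\<And>i j. 0 \<le> \<rho> i j" "plan_cost I J c a v \<rho> < plan_value I J c a v + e/2"
      using plan_value_approx[of "e/2" I J c a v] e by auto
    have "plan_value I J c a (\<lambda>k. u k + v k)
        \<le> plan_cost I J c a (\<lambda>k. u k + v k) (\<lambda>i j. \<pi> i j + \<rho> i j)"
      using \<pi> \<rho> by (intro le) auto
    also have "\<dots> \<le> plan_cost I J c a u \<pi> + plan_cost I J c a v \<rho>"
      by (rule plan_cost_add[OF a])
    finally show "plan_value I J c a (\<lambda>k. u k + v k)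
        \<le> plan_value I J c a u + plan_value I J c a v + e"
      using \<pi> \<rho> by simp
  qed
next
  note le = plan_value_le[of a I J c, OF a c]
  show "plan_value I J c a (\<lambda>k. 0) = 0"
  proof (rule antisym)
    show "plan_value I J c a (\<lambda>k. 0) \<le> 0"
      using le[of "\<lambda>_ _. 0" "\<lambda>_. 0"] by (simp add: plan_cost_def)
    show "0 \<le> plan_value I J c a (\<lambda>k. 0)"
      unfolding plan_value_def
      by (intro cINF_greatest plan_cost_nonneg a c) (auto intro: exI[of _ "\<lambda>_ _. 0"])
  qed
next
  note le = plan_value_le[of a I J c, OF a c]
  fix t :: real and u :: "_ + _ \<Rightarrow> real" assume t: "0 < t"
  show "plan_value I J c a (\<lambda>k. t * u k) \<le> t * plan_value I J c a u"
  proof (rule field_le_epsilon)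
    fix e :: real assume e: "0 < e"
    obtain \<pi> where \<pi>: "\<And>i j. 0 \<le> \<pi> i j" "plan_cost I J c a u \<pi> < plan_value I J c a u + e/t"
      using plan_value_approx[of "e/t" I J c a u] e t by auto
    have "plan_value I J c a (\<lambda>k. t * u k) \<le> plan_cost I J c a (\<lambda>k. t * u k) (\<lambda>i j. t * \<pi> i j)"
      using \<pi> t by (intro le) auto
    also have "\<dots> = t * plan_cost I J c a u \<pi>"
      using t by (intro plan_cost_scale) auto
    also have "\<dots> \<le> t * (plan_value I J c a u + e/t)"
      using \<pi> t by (intro mult_left_mono) auto
    also have "\<dots> = t * plan_value I J c a u + e"
      using t by (simp add: algebra_simps)
    finally show "plan_value I J c a (\<lambda>k. t * u k) \<le> t * plan_value I J c a u + e" .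
  qed
qed

text \<open>
  The linear functional that supports the sublinear optimal value at \<open>(m, n)\<close> consists of
  optimal potentials. Its constraints are read off from simple test vectors: leaving one unit at a
  single point unmatched costs \<open>a\<close>, which bounds \<open>f\<close> and \<open>g\<close>, and moving one unit from \<open>i\<close> to \<open>j\<close>
  costs \<open>c i j\<close>, which bounds \<open>f i + g j\<close>. The slack \<open>e\<close> avoids having to show that an optimal plan
  exists.
\<close>

lemma finite_transport_duality:
  fixes m :: "'i \<Rightarrow> real" and n :: "'j \<Rightarrow> real"
  assumes I: "finite I" and J: "finite J" and a: "0 \<le> a"
    and c: "\<And>i j. i \<in> I \<Longrightarrow> j \<in> J \<Longrightarrow> 0 \<le> c i j" and e: "0 < e"
  obtains \<pi> f g where "\<And>i j. 0 \<le> \<pi> i j"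
    "\<And>i. i \<in> I \<Longrightarrow> \<bar>f i\<bar> \<le> a" "\<And>j. j \<in> J \<Longrightarrow> \<bar>g j\<bar> \<le> a"
    "\<And>i j. i \<in> I \<Longrightarrow> j \<in> J \<Longrightarrow> f i + g j \<le> c i j"
    "a * (\<Sum>i\<in>I. \<bar>m i - (\<Sum>j\<in>J. \<pi> i j)\<bar>) + a * (\<Sum>j\<in>J. \<bar>n j - (\<Sum>i\<in>I. \<pi> i j)\<bar>)
       + (\<Sum>i\<in>I. \<Sum>j\<in>J. c i j * \<pi> i j)
     \<le> (\<Sum>i\<in>I. f i * m i) + (\<Sum>j\<in>J. g j * n j) + e"
proof -
  let ?p = "plan_value I J c a"
  define u\<^sub>0 where "u\<^sub>0 = case_sum (\<lambda>i. if i \<in> I then m i else 0) (\<lambda>j. if j \<in> J then n j else 0)"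
  have sum_Plus: "(\<Sum>k\<in>I <+> J. F k) = (\<Sum>i\<in>I. F (Inl i)) + (\<Sum>j\<in>J. F (Inr j))"
    for F :: "'i + 'j \<Rightarrow> real"
    using I J by (simp add: sum.Plus)
  have supp: "u\<^sub>0 k = 0" if "k \<notin> I <+> J" for k
    using that by (cases k) (auto simp: u\<^sub>0_def)
  obtain F where F: "\<And>u. (\<And>k. k \<notin> I <+> J \<Longrightarrow> u k = 0) \<Longrightarrow> (\<Sum>k\<in>I <+> J. F k * u k) \<le> ?p u"
    "?p u\<^sub>0 \<le> (\<Sum>k\<in>I <+> J. F k * u\<^sub>0 k)"
  proof (rule finite_Hahn_Banach[where p = ?p and K = "I <+> J" and u\<^sub>0 = u\<^sub>0])
    show "sublinear ?p" by (rule sublinear_plan_value[OF a c])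
    show "finite (I <+> J)" using I J by simp
  qed (use supp in blast)+
  obtain \<pi> where \<pi>: "\<And>i j. 0 \<le> \<pi> i j" "plan_cost I J c a u\<^sub>0 \<pi> < ?p u\<^sub>0 + e"
    using plan_value_approx[of "e" I J c a u\<^sub>0] e by auto
  note le = plan_value_le[of a I J c, OF a c]
  have test: "(\<Sum>k\<in>I <+> J. F k * u k) \<le> plan_cost I J c a u \<rho>" if "\<And>i j. 0 \<le> \<rho> i j" for u \<rho>
  proof -
    \<comment> \<open>Neither side sees the entries of \<open>u\<close> outside \<open>I <+> J\<close>.\<close>
    let ?u = "\<lambda>k. if k \<in> I <+> J then u k else 0"
    have "(\<Sum>k\<in>I <+> J. F k * u k) = (\<Sum>k\<in>I <+> J. F k * ?u k)"
      by (intro sum.cong) auto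
    also have "\<dots> \<le> ?p ?u"
      by (intro F(1)) auto
    also have "\<dots> \<le> plan_cost I J c a ?u \<rho>"
      by (intro le that)
    also have "\<dots> = plan_cost I J c a u \<rho>"
      by (simp add: plan_cost_def InlI InrI cong: sum.cong)
    finally show ?thesis .
  qed
  show thesis
  proof (rule that[of \<pi> "\<lambda>i. F (Inl i)" "\<lambda>j. F (Inr j)"])
    show "0 \<le> \<pi> i j" for i j by (rule \<pi>)
  next
    fix i assume i: "i \<in> I"
    have "F (Inl i) * s \<le> a * \<bar>s\<bar>" for s
      using test[where u = "case_sum (\<lambda>i'. if i' = i then s else 0) (\<lambda>_. 0)" and \<rho> = "\<lambda>_ _. 0"] i I
      by (auto simp: sum_Plus plan_cost_def if_distrib[of "(*) _"] if_distrib[of abs]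
          split: sum.splits cong: if_cong)
    from this[of 1] this[of "-1"] show "\<bar>F (Inl i)\<bar> \<le> a" by simp
  next
    fix j assume j: "j \<in> J"
    have "F (Inr j) * s \<le> a * \<bar>s\<bar>" for s
      using test[where u = "case_sum (\<lambda>_. 0) (\<lambda>j'. if j' = j then s else 0)" and \<rho> = "\<lambda>_ _. 0"] j J
      by (auto simp: sum_Plus plan_cost_def if_distrib[of "(*) _"] if_distrib[of abs]
          split: sum.splits cong: if_cong)
    from this[of 1] this[of "-1"] show "\<bar>F (Inr j)\<bar> \<le> a" by simp
  next
    fix i j assume ij: "i \<in> I" "j \<in> J"
    let ?\<rho> = "\<lambda>i' j'. if i' = i then if j' = j then 1 else 0 else (0::real)"
    have row: "(\<Sum>j'\<in>J. t j' * ?\<rho> i' j') = (if i' = i then t j else 0)" for i' t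
      using ij J by (cases "i' = i") (simp_all add: if_distrib[of "(*) _"] cong: if_cong)
    have \<rho>: "(\<Sum>j'\<in>J. ?\<rho> i' j') = (if i' = i then 1 else 0)"
      "(\<Sum>i'\<in>I. ?\<rho> i' j') = (if j' = j then 1 else 0)"
      "(\<Sum>i'\<in>I. \<Sum>j'\<in>J. c i' j' * ?\<rho> i' j') = c i j" for i' j'
      using ij I J row[of "\<lambda>_. 1"] unfolding row by simp_all
    show "F (Inl i) + F (Inr j) \<le> c i j"
      using test[where u = "case_sum (\<lambda>i'. if i' = i then 1 else 0) (\<lambda>j'. if j' = j then 1 else 0)" and \<rho> = ?\<rho>] ij I J
      unfolding plan_cost_def \<rho>
      by (auto simp: sum_Plus if_distrib[of "(*) _"] split: sum.splits cong: if_cong)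
  next
    have "plan_cost I J c a u\<^sub>0 \<pi> \<le> (\<Sum>k\<in>I <+> J. F k * u\<^sub>0 k) + e"
      using \<pi>(2) F(2) by simp
    then show "a * (\<Sum>i\<in>I. \<bar>m i - (\<Sum>j\<in>J. \<pi> i j)\<bar>) + a * (\<Sum>j\<in>J. \<bar>n j - (\<Sum>i\<in>I. \<pi> i j)\<bar>)
       + (\<Sum>i\<in>I. \<Sum>j\<in>J. c i j * \<pi> i j)
      \<le> (\<Sum>i\<in>I. F (Inl i) * m i) + (\<Sum>j\<in>J. F (Inr j) * n j) + e"
      by (simp add: plan_cost_def sum_Plus u\<^sub>0_def)
  qed
qed

section \<open>Test functions and finite Borel measures\<close>

lemma lip_seminorm_le_iff:
  fixes f :: "'a::metric_space \<Rightarrow> real"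
  assumes "0 \<le> b"
  shows "lip_seminorm f \<le> ennreal b \<longleftrightarrow> (\<forall>x y. \<bar>f x - f y\<bar> \<le> b * dist x y)"
proof -
  have "\<bar>f x - f y\<bar> / dist x y \<le> b \<longleftrightarrow> \<bar>f x - f y\<bar> \<le> b * dist x y" if "x \<noteq> y" for x y
    using that by (simp add: field_simps)
  then show ?thesis
    unfolding lip_seminorm_def using assms
    by (force simp: SUP_le_iff ennreal_le_iff)
qed

lemma test_functions_iff:
  "f \<in> test_functions a b \<longleftrightarrow>
     (\<forall>x. \<bar>apply_bcontfun f x\<bar> \<le> a) \<and>
     (\<forall>x y. \<bar>apply_bcontfun f x - apply_bcontfun f y\<bar> \<le> b * dist x y)"
  if "0 \<le> b" for f :: "'a::metric_space \<Rightarrow>\<^sub>C real"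
proof -
  have "norm f \<le> a \<longleftrightarrow> (\<forall>x. \<bar>apply_bcontfun f x\<bar> \<le> a)"
    using norm_bound[of f a] norm_bounded[of f] by (fastforce intro: order_trans)
  then show ?thesis
    by (simp add: test_functions_def lip_seminorm_le_iff[OF that])
qed

lemma finite_borel_measuresD:
  assumes "\<mu> \<in> finite_borel_measures"
  shows "finite_measure \<mu>" "sets \<mu> = sets borel" "space \<mu> = UNIV"
  using assms sets_eq_imp_space_eq[of \<mu> borel] by (auto simp: finite_borel_measures_def)

lemma bounded_integrable:
  fixes f :: "'a::metric_space \<Rightarrow> real"
  assumes "\<mu> \<in> finite_borel_measures" "f \<in> borel_measurable borel" "\<And>x. \<bar>f x\<bar> \<le> c"
  shows "integrable \<mu> f"
  using assms finite_borel_measuresD[OF assms(1)]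
  by (intro finite_measure.integrable_const_bound[of _ _ c]) (auto cong: measurable_cong_sets)

lemma abs_integral_le:
  fixes f :: "'a::metric_space \<Rightarrow> real"
  assumes "\<mu> \<in> finite_borel_measures" "f \<in> borel_measurable borel" "\<And>x. \<bar>f x\<bar> \<le> c"
  shows "\<bar>\<integral>x. f x \<partial>\<mu>\<bar> \<le> c * measure \<mu> UNIV"
proof -
  interpret finite_measure \<mu> using finite_borel_measuresD[OF assms(1)] by simp
  have "\<bar>\<integral>x. f x \<partial>\<mu>\<bar> \<le> (\<integral>x. \<bar>f x\<bar> \<partial>\<mu>)" by (rule integral_abs_bound)
  also have "\<dots> \<le> (\<integral>x. c \<partial>\<mu>)"
    using bounded_integrable[OF assms] assms by (intro integral_mono) auto
  finally show ?thesis using finite_borel_measuresD[OF assms(1)] by (simp add: mult.commute)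
qed

section \<open>Total variation\<close>

lemma sum_measure_partition:
  assumes \<mu>: "\<mu> \<in> finite_borel_measures"
    and P: "finite P" "P \<subseteq> sets borel" "disjoint P" "\<Union>P = UNIV"
  shows "(\<Sum>A\<in>P. measure \<mu> A) = measure \<mu> UNIV"
proof -
  interpret finite_measure \<mu> using finite_borel_measuresD[OF \<mu>] by simp
  have "measure \<mu> (\<Union>A\<in>P. A) = (\<Sum>A\<in>P. measure \<mu> A)"
    using P finite_borel_measuresD(2)[OF \<mu>]
    by (intro finite_measure_finite_Union) (auto simp: disjoint_family_on_def disjoint_def)
  then show ?thesis using P by simp
qed

lemma sum_abs_signed_diff_le:
  assumes \<mu>: "\<mu> \<in> finite_borel_measures" and \<nu>: "\<nu> \<in> finite_borel_measures"
    and P: "finite P" "P \<subseteq> sets borel" "disjoint P" "\<Union>P = UNIV"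
  shows "(\<Sum>A\<in>P. \<bar>signed_diff \<mu> \<nu> A\<bar>) \<le> total_variation (signed_diff \<mu> \<nu>)"
  unfolding total_variation_def
proof (rule cSUP_upper)
  show "bdd_above ((\<lambda>P. \<Sum>A\<in>P. \<bar>signed_diff \<mu> \<nu> A\<bar>) `
      {P. finite P \<and> P \<subseteq> sets borel \<and> disjoint P \<and> \<Union>P = UNIV})"
  proof (rule bdd_aboveI2)
    fix Q :: "'a set set" assume Q: "Q \<in> {P. finite P \<and> P \<subseteq> sets borel \<and> disjoint P \<and> \<Union>P = UNIV}"
    have "(\<Sum>A\<in>Q. \<bar>signed_diff \<mu> \<nu> A\<bar>) \<le> (\<Sum>A\<in>Q. measure \<mu> A + measure \<nu> A)"
      by (intro sum_mono) (auto simp: signed_diff_def abs_le_iff add_increasing add_increasing2)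
    also have "\<dots> = measure \<mu> UNIV + measure \<nu> UNIV"
      using Q by (simp add: sum.distrib sum_measure_partition[OF \<mu>] sum_measure_partition[OF \<nu>])
    finally show "(\<Sum>A\<in>Q. \<bar>signed_diff \<mu> \<nu> A\<bar>) \<le> measure \<mu> UNIV + measure \<nu> UNIV" .
  qed
qed (use P in auto)

lemma total_variation_nonneg:
  assumes "\<mu> \<in> finite_borel_measures" "\<nu> \<in> finite_borel_measures"
  shows "0 \<le> total_variation (signed_diff \<mu> \<nu>)"
  using sum_abs_signed_diff_le[OF assms, of "{UNIV}"] by simp

lemma nn_integral_on_set_mono_measure:
  fixes \<mu> \<nu> :: "'a measure"
  assumes s: "sets \<mu> = sets \<nu>" and Y: "Y \<in> sets \<nu>"
    and le: "\<And>X. X \<in> sets \<nu> \<Longrightarrow> X \<subseteq> Y \<Longrightarrow> emeasure \<mu> X \<le> emeasure \<nu> X"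
    and f: "f \<in> borel_measurable \<nu>"
  shows "(\<integral>\<^sup>+x. f x * indicator Y x \<partial>\<mu>) \<le> (\<integral>\<^sup>+x. f x * indicator Y x \<partial>\<nu>)"
proof -
  have f': "f \<in> borel_measurable \<mu>" and Y': "Y \<in> sets \<mu>"
    using f Y s by (auto cong: measurable_cong_sets)
  have "density \<mu> (indicator Y) \<le> density \<nu> (indicator Y)"
    using Y Y' s le
    by (subst le_measure) (auto simp: emeasure_density indicator_inter_arith[symmetric])
  then have "nn_integral (density \<mu> (indicator Y)) f \<le> nn_integral (density \<nu> (indicator Y)) f"
    using s by (intro nn_integral_mono_measure) auto
  then show ?thesis
    using f f' Y Y' by (simp add: nn_integral_density mult.commute)
qed

lemma integral_on_set_mono_measure:
  fixes f :: "'a::metric_space \<Rightarrow> real"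
  assumes \<mu>: "\<mu> \<in> finite_borel_measures" and \<nu>: "\<nu> \<in> finite_borel_measures"
    and Y: "Y \<in> sets borel"
    and le: "\<And>X. X \<in> sets borel \<Longrightarrow> X \<subseteq> Y \<Longrightarrow> emeasure \<mu> X \<le> emeasure \<nu> X"
    and f: "f \<in> borel_measurable borel" "\<And>x. 0 \<le> f x" "\<And>x. f x \<le> c"
  shows "(\<integral>x. f x * indicator Y x \<partial>\<mu>) \<le> (\<integral>x. f x * indicator Y x \<partial>\<nu>)"
proof -
  note [measurable] = f(1) Y
  have int: "integrable \<rho> (\<lambda>x. f x * indicator Y x)" if "\<rho> \<in> finite_borel_measures" for \<rho>
    using f that by (intro bounded_integrable[of _ _ c]) (auto simp: indicator_def order_trans[OF f(2,3)])
  have nn: "ennreal (\<integral>x. f x * indicator Y x \<partial>\<rho>) = (\<integral>\<^sup>+x. ennreal (f x) * indicator Y x \<partial>\<rho>)"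
    if "\<rho> \<in> finite_borel_measures" for \<rho>
    using int[OF that] f
    by (subst nn_integral_eq_integral[symmetric])
       (auto intro!: nn_integral_cong simp: indicator_def)
  have "(\<integral>\<^sup>+x. ennreal (f x) * indicator Y x \<partial>\<mu>) \<le> (\<integral>\<^sup>+x. ennreal (f x) * indicator Y x \<partial>\<nu>)"
    using finite_borel_measuresD[OF \<mu>] finite_borel_measuresD[OF \<nu>] le Y
    by (intro nn_integral_on_set_mono_measure) (auto cong: measurable_cong_sets)
  then show ?thesis
    unfolding nn[OF \<mu>, symmetric] nn[OF \<nu>, symmetric] using f
    by (subst (asm) ennreal_le_iff) (auto intro!: integral_nonneg_AE)
qed

text \<open>
  On a positive set \<open>Y\<close> of a Hahn decomposition \<open>\<mu> - \<nu>\<close> is a nonnegative measure, so integrating the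
  nonnegative function \<open>a - f\<close> there gives \<open>\<integral>\<^sub>Y f d(\<mu> - \<nu>) \<le> a (\<mu> - \<nu>)(Y)\<close>. Symmetrically, \<open>a + f\<close> on the
  complement gives the bound \<open>a (\<nu> - \<mu>)(- Y)\<close>. The partition \<open>{Y, - Y}\<close> shows that the two bounds add up
  to at most \<open>a\<close> times the total variation.
\<close>

lemma integral_diff_le_total_variation:
  fixes f :: "'a::metric_space \<Rightarrow> real"
  assumes \<mu>: "\<mu> \<in> finite_borel_measures" and \<nu>: "\<nu> \<in> finite_borel_measures"
    and f: "f \<in> borel_measurable borel" "\<And>x. \<bar>f x\<bar> \<le> a"
  shows "(\<integral>x. f x \<partial>\<mu>) - (\<integral>x. f x \<partial>\<nu>) \<le> a * total_variation (signed_diff \<mu> \<nu>)"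
proof -
  note \<mu>' = finite_borel_measuresD[OF \<mu>] and \<nu>' = finite_borel_measuresD[OF \<nu>]
  interpret M: finite_measure \<mu> by (rule \<mu>')
  interpret N: finite_measure \<nu> by (rule \<nu>')
  note [measurable] = f(1)
  have a: "0 \<le> a" using f(2)[of undefined] by simp
  obtain Y where Y[measurable]: "Y \<in> sets borel"
    and pos: "\<And>X. X \<in> sets borel \<Longrightarrow> X \<subseteq> Y \<Longrightarrow> emeasure \<nu> X \<le> emeasure \<mu> X"
    and neg: "\<And>X. X \<in> sets borel \<Longrightarrow> X \<inter> Y = {} \<Longrightarrow> emeasure \<mu> X \<le> emeasure \<nu> X"
    using finite_unsigned_Hahn_decomposition[of \<mu> \<nu>] \<mu>' \<nu>' by auto
  have int: "integrable \<rho> (\<lambda>x. f x * indicator Z x)" "integrable \<rho> (\<lambda>x. a * indicator Z x)"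
    if "\<rho> \<in> finite_borel_measures" "Z \<in> sets borel" for \<rho> Z
  proof -
    note [measurable] = that(2)
    show "integrable \<rho> (\<lambda>x. f x * indicator Z x)" "integrable \<rho> (\<lambda>x. a * indicator Z x)"
      by (rule bounded_integrable[OF that(1), where c = a]; simp add: f(2) a indicator_def)+
  qed
  have const: "(\<integral>x. a * indicator Z x \<partial>\<rho>) = a * measure \<rho> Z"
    if "\<rho> \<in> finite_borel_measures" "Z \<in> sets borel" for \<rho> Z
    using finite_borel_measuresD[OF that(1)] that(2) by simp
  have bounds: "0 \<le> a - f x" "a - f x \<le> 2 * a" "0 \<le> a + f x" "a + f x \<le> 2 * a" for x
    using f(2)[of x] by auto
  have "(\<integral>x. (a - f x) * indicator Y x \<partial>\<nu>) \<le> (\<integral>x. (a - f x) * indicator Y x \<partial>\<mu>)"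
    by (intro integral_on_set_mono_measure[OF \<nu> \<mu>, where c = "2 * a"] pos)
       (use Y bounds in auto)
  then have Y1: "(\<integral>x. f x * indicator Y x \<partial>\<mu>) - (\<integral>x. f x * indicator Y x \<partial>\<nu>)
      \<le> a * (measure \<mu> Y - measure \<nu> Y)"
    using int[OF \<mu> Y] int[OF \<nu> Y] const[OF \<mu> Y] const[OF \<nu> Y]
    by (simp add: left_diff_distrib right_diff_distrib \<mu>'(3) \<nu>'(3))
  have "(\<integral>x. (a + f x) * indicator (- Y) x \<partial>\<mu>) \<le> (\<integral>x. (a + f x) * indicator (- Y) x \<partial>\<nu>)"
    by (intro integral_on_set_mono_measure[OF \<mu> \<nu>, where c = "2 * a"] neg)
       (use Y bounds in auto)
  then have Y2: "(\<integral>x. f x * indicator (- Y) x \<partial>\<mu>) - (\<integral>x. f x * indicator (- Y) x \<partial>\<nu>)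
      \<le> a * (measure \<nu> (- Y) - measure \<mu> (- Y))"
    using int[OF \<mu>, of "- Y"] int[OF \<nu>, of "- Y"] const[OF \<mu>, of "- Y"] const[OF \<nu>, of "- Y"]
    by (simp add: distrib_right right_diff_distrib \<mu>'(3) \<nu>'(3))
  have split: "(\<integral>x. f x \<partial>\<rho>) = (\<integral>x. f x * indicator Y x \<partial>\<rho>) + (\<integral>x. f x * indicator (- Y) x \<partial>\<rho>)"
    if "\<rho> \<in> finite_borel_measures" for \<rho>
  proof -
    have "(\<integral>x. f x \<partial>\<rho>) = (\<integral>x. f x * indicator Y x + f x * indicator (- Y) x \<partial>\<rho>)"
      by (intro Bochner_Integration.integral_cong) (auto simp: indicator_def)
    also have "\<dots> = (\<integral>x. f x * indicator Y x \<partial>\<rho>) + (\<integral>x. f x * indicator (- Y) x \<partial>\<rho>)"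
      by (intro Bochner_Integration.integral_add int(1)[OF that]) auto
    finally show ?thesis .
  qed
  have "(measure \<mu> Y - measure \<nu> Y) + (measure \<nu> (- Y) - measure \<mu> (- Y))
      \<le> (\<Sum>A\<in>{Y, - Y}. \<bar>signed_diff \<mu> \<nu> A\<bar>)"
  proof -
    have "Y \<noteq> - Y" by blast
    then show ?thesis by (simp add: signed_diff_def)
  qed
  also have "\<dots> \<le> total_variation (signed_diff \<mu> \<nu>)"
    by (intro sum_abs_signed_diff_le \<mu> \<nu>) (auto simp: disjoint_def)
  finally have "a * ((measure \<mu> Y - measure \<nu> Y) + (measure \<nu> (- Y) - measure \<mu> (- Y)))
      \<le> a * total_variation (signed_diff \<mu> \<nu>)"
    using a by (rule mult_left_mono)
  with Y1 Y2 show ?thesis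
    unfolding split[OF \<mu>] split[OF \<nu>] by (simp add: distrib_left)
qed

section \<open>Couplings and the Wasserstein distance\<close>

lemma product_borel_measureD:
  fixes \<gamma> :: "('a::polish_space \<times> 'a) measure"
  assumes "sets \<gamma> = sets borel"
  shows "sets \<gamma> = sets (borel \<Otimes>\<^sub>M borel)" "space \<gamma> = UNIV"
    "fst \<in> borel_measurable \<gamma>" "snd \<in> borel_measurable \<gamma>"
proof -
  show s: "sets \<gamma> = sets (borel \<Otimes>\<^sub>M borel)"
    using assms by (subst borel_prod)
  show "space \<gamma> = UNIV"
    using sets_eq_imp_space_eq[OF assms] by simp
  show "fst \<in> borel_measurable \<gamma>" "snd \<in> borel_measurable \<gamma>"
    by (simp_all cong: measurable_cong_sets[OF s refl])
qed

lemma coupling_marginals: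
  fixes \<mu> \<nu> :: "'a::polish_space measure"
  assumes \<pi>: "\<pi> \<in> couplings \<mu> \<nu>"
    and \<mu>: "\<mu> \<in> finite_borel_measures" and \<nu>: "\<nu> \<in> finite_borel_measures"
  shows "\<mu> = scale_measure (measure \<mu> UNIV) (distr \<pi> borel fst)"
    "\<nu> = scale_measure (measure \<nu> UNIV) (distr \<pi> borel snd)"
proof -
  interpret prob_space \<pi> using \<pi> by (simp add: couplings_def)
  interpret M: finite_measure \<mu> by (rule finite_borel_measuresD[OF \<mu>])
  interpret N: finite_measure \<nu> by (rule finite_borel_measuresD[OF \<nu>])
  have "sets \<pi> = sets borel" using \<pi> by (simp add: couplings_def)
  note sp = product_borel_measureD(2)[OF this] and [measurable] = product_borel_measureD(3,4)[OF this]
  show "\<mu> = scale_measure (measure \<mu> UNIV) (distr \<pi> borel fst)"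
  proof (rule measure_eqI)
    show "sets \<mu> = sets (scale_measure (measure \<mu> UNIV) (distr \<pi> borel fst))"
      using finite_borel_measuresD[OF \<mu>] by simp
    fix A assume "A \<in> sets \<mu>"
    then have A: "A \<in> sets borel" using finite_borel_measuresD[OF \<mu>] by simp
    moreover have "fst -` A = A \<times> (UNIV :: 'a set)" by auto
    ultimately show "emeasure \<mu> A = emeasure (scale_measure (measure \<mu> UNIV) (distr \<pi> borel fst)) A"
      using \<pi> by (auto simp: emeasure_distr sp couplings_def M.emeasure_eq_measure
          emeasure_eq_measure ennreal_mult[symmetric])
  qed
  show "\<nu> = scale_measure (measure \<nu> UNIV) (distr \<pi> borel snd)"
  proof (rule measure_eqI)
    show "sets \<nu> = sets (scale_measure (measure \<nu> UNIV) (distr \<pi> borel snd))"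
      using finite_borel_measuresD[OF \<nu>] by simp
    fix A assume "A \<in> sets \<nu>"
    then have A: "A \<in> sets borel" using finite_borel_measuresD[OF \<nu>] by simp
    moreover have "snd -` A = (UNIV :: 'a set) \<times> A" by auto
    ultimately show "emeasure \<nu> A = emeasure (scale_measure (measure \<nu> UNIV) (distr \<pi> borel snd)) A"
      using \<pi> by (auto simp: emeasure_distr sp couplings_def N.emeasure_eq_measure
          emeasure_eq_measure ennreal_mult[symmetric])
  qed
qed

lemma integral_scale_measure_real:
  fixes f :: "'a \<Rightarrow> real"
  assumes "0 \<le> r" "f \<in> borel_measurable M"
  shows "(\<integral>x. f x \<partial>scale_measure (ennreal r) M) = r * (\<integral>x. f x \<partial>M)"
proof -
  have "scale_measure (ennreal r) M = density M (\<lambda>x. ennreal r)"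
    by (rule measure_eqI) (auto simp: emeasure_density nn_integral_cmult_indicator)
  then show ?thesis using assms by (simp add: integral_density)
qed

lemma coupling_dual_bound:
  fixes \<mu> \<nu> :: "'a::polish_space measure"
  assumes \<pi>: "\<pi> \<in> couplings \<mu> \<nu>" and eq: "measure \<mu> UNIV = measure \<nu> UNIV"
    and \<mu>: "\<mu> \<in> finite_borel_measures" and \<nu>: "\<nu> \<in> finite_borel_measures"
    and b: "0 \<le> b" and f: "\<And>x. \<bar>f x\<bar> \<le> a" "\<And>x y. f x - f y \<le> b * dist x y" "f \<in> borel_measurable borel"
    and fin: "(\<integral>\<^sup>+ p. ennreal (dist (fst p) (snd p)) \<partial>\<pi>) < \<infinity>"
  shows "(\<integral>x. f x \<partial>\<mu>) - (\<integral>x. f x \<partial>\<nu>)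
    \<le> b * (measure \<mu> UNIV * enn2real (\<integral>\<^sup>+ p. ennreal (dist (fst p) (snd p)) \<partial>\<pi>))"
proof -
  interpret prob_space \<pi> using \<pi> by (simp add: couplings_def)
  have "sets \<pi> = sets borel" using \<pi> by (simp add: couplings_def)
  note [measurable] = product_borel_measureD(3,4)[OF this]
  note [measurable] = f(3)
  have int: "integrable \<pi> (\<lambda>p. dist (fst p) (snd p))"
    using fin by (intro integrableI_bounded) auto
  have int1: "integrable \<pi> (\<lambda>p. f (fst p))" and int2: "integrable \<pi> (\<lambda>p. f (snd p))"
    using f(1) by (auto intro!: integrable_const_bound[of _ a])
  have "(\<integral>x. f x \<partial>\<mu>) = measure \<mu> UNIV * (\<integral>p. f (fst p) \<partial>\<pi>)"
    by (subst coupling_marginals(1)[OF \<pi> \<mu> \<nu>])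
       (simp add: integral_scale_measure_real integral_distr)
  moreover have "(\<integral>x. f x \<partial>\<nu>) = measure \<mu> UNIV * (\<integral>p. f (snd p) \<partial>\<pi>)"
    unfolding eq by (subst coupling_marginals(2)[OF \<pi> \<mu> \<nu>])
       (simp add: integral_scale_measure_real integral_distr)
  ultimately have "(\<integral>x. f x \<partial>\<mu>) - (\<integral>x. f x \<partial>\<nu>) = measure \<mu> UNIV * (\<integral>p. f (fst p) - f (snd p) \<partial>\<pi>)"
    using int1 int2 by (simp add: right_diff_distrib)
  also have "\<dots> \<le> measure \<mu> UNIV * (\<integral>p. b * dist (fst p) (snd p) \<partial>\<pi>)"
    using int int1 int2 f(2) by (intro mult_left_mono integral_mono) auto
  also have "(\<integral>p. b * dist (fst p) (snd p) \<partial>\<pi>)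
      = b * enn2real (\<integral>\<^sup>+ p. ennreal (dist (fst p) (snd p)) \<partial>\<pi>)"
    by (simp add: integral_eq_nn_integral)
  finally show ?thesis by (simp add: mult_ac)
qed

lemma finite_borel_measures1_moment:
  fixes \<mu> :: "'a::metric_space measure"
  assumes "\<mu> \<in> finite_borel_measures1"
  shows "(\<integral>\<^sup>+ x. ennreal (dist x z) \<partial>\<mu>) < \<infinity>"
proof -
  obtain x0 where \<mu>: "\<mu> \<in> finite_borel_measures" and x0: "(\<integral>\<^sup>+ x. ennreal (dist x x0) \<partial>\<mu>) < \<infinity>"
    using assms by (auto simp: finite_borel_measures1_def)
  note \<mu>' = finite_borel_measuresD[OF \<mu>]
  interpret finite_measure \<mu> by (rule \<mu>')
  have [measurable]: "(\<lambda>x. dist x y) \<in> borel_measurable \<mu>" for y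
    by (subst measurable_cong_sets[OF \<mu>'(2) refl])
       (intro borel_measurable_continuous_onI continuous_intros)
  have "(\<integral>\<^sup>+ x. ennreal (dist x z) \<partial>\<mu>) \<le> (\<integral>\<^sup>+ x. ennreal (dist x x0) + ennreal (dist x0 z) \<partial>\<mu>)"
    by (intro nn_integral_mono) (simp add: ennreal_plus[symmetric] dist_triangle del: ennreal_plus)
  also have "\<dots> = (\<integral>\<^sup>+ x. ennreal (dist x x0) \<partial>\<mu>) + ennreal (dist x0 z) * emeasure \<mu> (space \<mu>)"
    by (subst nn_integral_add) auto
  also have "\<dots> < \<infinity>"
    using x0 by (simp add: less_top[symmetric] ennreal_mult_eq_top_iff)
  finally show ?thesis .
qed

lemma coupling_normalized_plan:
  fixes \<gamma> :: "('a::polish_space \<times> 'a) measure"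
  assumes \<gamma>: "sets \<gamma> = sets borel" "finite_measure \<gamma>" and mass: "0 < measure \<gamma> UNIV"
  shows "scale_measure (ennreal (inverse (measure \<gamma> UNIV))) \<gamma>
    \<in> couplings (distr \<gamma> borel fst) (distr \<gamma> borel snd)"
proof -
  interpret finite_measure \<gamma> by (rule \<gamma>)
  let ?m = "measure \<gamma> UNIV" and ?\<pi> = "scale_measure (ennreal (inverse (measure \<gamma> UNIV))) \<gamma>"
  note sp = product_borel_measureD(2)[OF \<gamma>(1)]
    and [measurable] = product_borel_measureD(3,4)[OF \<gamma>(1)]
  have pre: "fst -` A = A \<times> UNIV" "snd -` A = UNIV \<times> A" for A :: "'a set" by auto
  have m: "measure ?\<pi> X = inverse ?m * measure \<gamma> X" for X
    unfolding measure_def[of ?\<pi>] emeasure_scale_measure emeasure_eq_measure enn2real_mult by simp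
  show ?thesis
    unfolding couplings_def
  proof (intro CollectI conjI ballI)
    show "sets ?\<pi> = sets borel" using \<gamma> by simp
    show "prob_space ?\<pi>"
      using mass by (intro prob_spaceI)
        (simp add: space_scale_measure sp emeasure_eq_measure ennreal_mult[symmetric])
  qed (use mass in \<open>simp_all add: measure_distr sp m pre\<close>)
qed

text \<open>
  An unnormalised plan \<open>\<gamma>\<close> bounds the distance between its own marginals: if its mass is positive,
  dividing by it gives a coupling, and if its mass is \<open>0\<close>, the distance is \<open>0\<close> by the factor
  \<open>measure \<mu> UNIV\<close> in its definition.
\<close>

lemma wasserstein1_le_plan_cost:
  fixes \<gamma> :: "('a::polish_space \<times> 'a) measure"
  assumes \<gamma>: "sets \<gamma> = sets borel" "finite_measure \<gamma>"
    and cost: "(\<integral>\<^sup>+ p. ennreal (dist (fst p) (snd p)) \<partial>\<gamma>) \<le> ennreal C" and C: "0 \<le> C"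
  shows "wasserstein1 (distr \<gamma> borel fst) (distr \<gamma> borel snd) \<le> C"
proof -
  interpret finite_measure \<gamma> by (rule \<gamma>)
  let ?m = "measure \<gamma> UNIV"
  note sp = product_borel_measureD(2)[OF \<gamma>(1)]
    and [measurable] = product_borel_measureD(3,4)[OF \<gamma>(1)]
  have mass: "measure (distr \<gamma> borel fst) UNIV = ?m"
    by (simp add: measure_distr sp)
  show ?thesis
  proof (cases "?m = 0")
    case True
    then show ?thesis using C mass by (simp add: wasserstein1_def)
  next
    case False
    then have m: "0 < ?m" by (simp add: zero_less_measure_iff)
    have "(INF \<pi>\<in>couplings (distr \<gamma> borel fst) (distr \<gamma> borel snd).
        \<integral>\<^sup>+ p. ennreal (dist (fst p) (snd p)) \<partial>\<pi>)
      \<le> (\<integral>\<^sup>+ p. ennreal (dist (fst p) (snd p)) \<partial>scale_measure (ennreal (inverse ?m)) \<gamma>)"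
      using coupling_normalized_plan[OF \<gamma> m] by (rule INF_lower)
    also have "\<dots> = ennreal (inverse ?m) * (\<integral>\<^sup>+ p. ennreal (dist (fst p) (snd p)) \<partial>\<gamma>)"
      by (intro nn_integral_scale_measure) measurable
    also have "\<dots> \<le> ennreal (inverse ?m) * ennreal C"
      using cost by (intro mult_left_mono) auto
    also have "\<dots> = ennreal (C / ?m)"
      using m C by (simp add: ennreal_mult[symmetric] divide_inverse mult.commute)
    finally have "enn2real (INF \<pi>\<in>couplings (distr \<gamma> borel fst) (distr \<gamma> borel snd).
        \<integral>\<^sup>+ p. ennreal (dist (fst p) (snd p)) \<partial>\<pi>) \<le> C / ?m" (is "?W \<le> _")
      using m C by (intro enn2real_leI divide_nonneg_pos)
    then have "?m * ?W \<le> ?m * (C / ?m)"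
      by (rule mult_left_mono) simp
    then show ?thesis
      unfolding wasserstein1_def mass using False by simp
  qed
qed

text \<open>
  The normalised product measure has finite cost, because
  \<open>dist x y \<le> dist x z + dist y z\<close> and both first moments are finite. Without a coupling of finite cost
  the infimum would be \<open>\<infinity>\<close>, which the conversion to a real number turns into \<open>0\<close>.
\<close>

lemma finite_cost_coupling:
  fixes \<mu> \<nu> :: "'a::polish_space measure"
  assumes \<mu>: "\<mu> \<in> finite_borel_measures1" and \<nu>: "\<nu> \<in> finite_borel_measures1"
    and eq: "measure \<mu> UNIV = measure \<nu> UNIV" and pos: "0 < measure \<mu> UNIV"
  shows "\<exists>\<pi>\<in>couplings \<mu> \<nu>. (\<integral>\<^sup>+ p. ennreal (dist (fst p) (snd p)) \<partial>\<pi>) < \<infinity>"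
proof -
  have \<mu>1: "\<mu> \<in> finite_borel_measures" and \<nu>1: "\<nu> \<in> finite_borel_measures"
    using \<mu> \<nu> by (auto simp: finite_borel_measures1_def)
  note \<mu>' = finite_borel_measuresD[OF \<mu>1] and \<nu>' = finite_borel_measuresD[OF \<nu>1]
  interpret M: finite_measure \<mu> by (rule \<mu>')
  interpret N: finite_measure \<nu> by (rule \<nu>')
  interpret P: pair_sigma_finite \<mu> \<nu> ..
  let ?m = "measure \<mu> UNIV"
  let ?\<pi> = "scale_measure (ennreal (inverse (?m * ?m))) (\<mu> \<Otimes>\<^sub>M \<nu>)"
  have s: "sets (\<mu> \<Otimes>\<^sub>M \<nu>) = sets (borel \<Otimes>\<^sub>M borel)"
    using \<mu>' \<nu>' by (intro sets_pair_measure_cong)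
  have UNIV: "UNIV \<in> sets (borel :: 'a measure)" by simp
  have times: "emeasure (\<mu> \<Otimes>\<^sub>M \<nu>) (A \<times> B) = ennreal (measure \<mu> A * measure \<nu> B)"
    if "A \<in> sets borel" "B \<in> sets borel" for A B
    using that \<mu>' \<nu>' by (simp add: N.emeasure_pair_measure_Times M.emeasure_eq_measure
        N.emeasure_eq_measure ennreal_mult)
  have meas: "measure ?\<pi> (A \<times> B) = inverse (?m * ?m) * (measure \<mu> A * measure \<nu> B)"
    if "A \<in> sets borel" "B \<in> sets borel" for A B
    unfolding measure_def[of ?\<pi>] emeasure_scale_measure times[OF that] enn2real_mult by simp
  have "?\<pi> \<in> couplings \<mu> \<nu>"
    unfolding couplings_def
  proof (intro CollectI conjI ballI)
    show "sets ?\<pi> = sets borel" using s by (subst borel_prod[symmetric]) simp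
    have "emeasure ?\<pi> (UNIV \<times> UNIV) = 1"
      using pos unfolding emeasure_scale_measure times[OF UNIV UNIV] eq[symmetric]
      by (simp add: ennreal_mult[symmetric] field_simps)
    moreover have "space ?\<pi> = UNIV \<times> UNIV"
      using \<mu>'(3) \<nu>'(3) by (simp only: space_scale_measure space_pair_measure)
    ultimately show "prob_space ?\<pi>"
      by (intro prob_spaceI) (simp only:)
    show "measure \<mu> UNIV * measure ?\<pi> (A \<times> UNIV) = measure \<mu> A" if "A \<in> sets borel" for A
      unfolding meas[OF that UNIV] eq[symmetric] using pos by simp
    show "measure \<nu> UNIV * measure ?\<pi> (UNIV \<times> B) = measure \<nu> B" if "B \<in> sets borel" for B
      unfolding meas[OF UNIV that] eq[symmetric] using pos by simp
  qed
  moreover have "(\<integral>\<^sup>+ p. ennreal (dist (fst p) (snd p)) \<partial>?\<pi>) < \<infinity>"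
  proof -
    fix z :: 'a
    have [measurable]: "(\<lambda>p. dist (fst p) (snd p)) \<in> borel_measurable (\<mu> \<Otimes>\<^sub>M \<nu>)"
      "(\<lambda>p. dist (fst p) z) \<in> borel_measurable (\<mu> \<Otimes>\<^sub>M \<nu>)"
      "(\<lambda>p. dist (snd p) z) \<in> borel_measurable (\<mu> \<Otimes>\<^sub>M \<nu>)"
      by (simp_all cong: measurable_cong_sets[OF s refl])
    have [measurable]: "(\<lambda>x. dist x z) \<in> borel_measurable \<mu>" "(\<lambda>x. dist x z) \<in> borel_measurable \<nu>"
      using \<mu>' \<nu>' by (simp_all cong: measurable_cong_sets)
    have "(\<integral>\<^sup>+ p. ennreal (dist (fst p) (snd p)) \<partial>(\<mu> \<Otimes>\<^sub>M \<nu>))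
        \<le> (\<integral>\<^sup>+ p. ennreal (dist (fst p) z) + ennreal (dist (snd p) z) \<partial>(\<mu> \<Otimes>\<^sub>M \<nu>))"
      by (intro nn_integral_mono) (simp add: ennreal_plus[symmetric] dist_triangle2 del: ennreal_plus)
    also have "\<dots> = (\<integral>\<^sup>+ p. ennreal (dist (fst p) z) \<partial>(\<mu> \<Otimes>\<^sub>M \<nu>))
        + (\<integral>\<^sup>+ p. ennreal (dist (snd p) z) \<partial>(\<mu> \<Otimes>\<^sub>M \<nu>))"
      by (intro nn_integral_add) measurable
    also have "(\<integral>\<^sup>+ p. ennreal (dist (fst p) z) \<partial>(\<mu> \<Otimes>\<^sub>M \<nu>))
        = (\<integral>\<^sup>+ x. \<integral>\<^sup>+ y. ennreal (dist x z) \<partial>\<nu> \<partial>\<mu>)"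
      by (subst N.nn_integral_fst[symmetric]) auto
    also have "\<dots> = (\<integral>\<^sup>+ x. ennreal (dist x z) \<partial>\<mu>) * emeasure \<nu> UNIV"
      by (simp add: nn_integral_multc \<nu>')
    also have "(\<integral>\<^sup>+ p. ennreal (dist (snd p) z) \<partial>(\<mu> \<Otimes>\<^sub>M \<nu>))
        = (\<integral>\<^sup>+ x. \<integral>\<^sup>+ y. ennreal (dist y z) \<partial>\<nu> \<partial>\<mu>)"
      by (subst N.nn_integral_fst[symmetric]) auto
    also have "\<dots> = (\<integral>\<^sup>+ y. ennreal (dist y z) \<partial>\<nu>) * emeasure \<mu> UNIV"
      by (simp add: \<mu>')
    also have "(\<integral>\<^sup>+ x. ennreal (dist x z) \<partial>\<mu>) * emeasure \<nu> UNIV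
        + (\<integral>\<^sup>+ y. ennreal (dist y z) \<partial>\<nu>) * emeasure \<mu> UNIV < \<infinity>"
      using finite_borel_measures1_moment[OF \<mu>, of z] finite_borel_measures1_moment[OF \<nu>, of z]
      by (simp add: ennreal_mult_eq_top_iff less_top[symmetric] M.emeasure_eq_measure N.emeasure_eq_measure)
    finally show ?thesis
      by (subst nn_integral_scale_measure) (auto simp: ennreal_mult_less_top)
  qed
  ultimately show ?thesis by blast
qed

text \<open>
  This is the easy half of Kantorovich duality: integrate \<open>f x - f y \<le> b * dist x y\<close> against each
  coupling.
\<close>

lemma wasserstein1_dual_bound:
  fixes \<mu> \<nu> :: "'a::polish_space measure"
  assumes \<mu>: "\<mu> \<in> finite_borel_measures1" and \<nu>: "\<nu> \<in> finite_borel_measures1"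
    and eq: "measure \<mu> UNIV = measure \<nu> UNIV"
    and b: "0 < b" and f: "\<And>x. \<bar>f x\<bar> \<le> a" "\<And>x y. f x - f y \<le> b * dist x y" "f \<in> borel_measurable borel"
  shows "(\<integral>x. f x \<partial>\<mu>) - (\<integral>x. f x \<partial>\<nu>) \<le> b * wasserstein1 \<mu> \<nu>"
proof (cases "measure \<mu> UNIV = 0")
  case True
  have "\<mu> \<in> finite_borel_measures" "\<nu> \<in> finite_borel_measures"
    using \<mu> \<nu> by (auto simp: finite_borel_measures1_def)
  then show ?thesis
    using abs_integral_le[of \<mu> f a] abs_integral_le[of \<nu> f a] f True eq
    by (simp add: wasserstein1_def)
next
  case False
  have \<mu>1: "\<mu> \<in> finite_borel_measures" and \<nu>1: "\<nu> \<in> finite_borel_measures"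
    using \<mu> \<nu> by (auto simp: finite_borel_measures1_def)
  let ?m = "measure \<mu> UNIV" and ?c = "\<lambda>\<pi>. \<integral>\<^sup>+ p. ennreal (dist (fst p) (snd p)) \<partial>\<pi>"
  let ?D = "(\<integral>x. f x \<partial>\<mu>) - (\<integral>x. f x \<partial>\<nu>)"
  let ?W = "INF \<pi>\<in>couplings \<mu> \<nu>. ?c \<pi>"
  have m: "0 < ?m" using False by (simp add: zero_less_measure_iff)
  have "ennreal (?D / (b * ?m)) \<le> ?W"
  proof (rule INF_greatest)
    fix \<pi> assume \<pi>: "\<pi> \<in> couplings \<mu> \<nu>"
    show "ennreal (?D / (b * ?m)) \<le> ?c \<pi>"
    proof (cases "?c \<pi> < \<infinity>")
      case True
      have "?D \<le> b * (?m * enn2real (?c \<pi>))"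
        using coupling_dual_bound[OF \<pi> eq \<mu>1 \<nu>1 _ f True] b by simp
      then have "?D / (b * ?m) \<le> enn2real (?c \<pi>)"
        using b m by (simp add: field_simps)
      then have "ennreal (?D / (b * ?m)) \<le> ennreal (enn2real (?c \<pi>))"
        by (rule ennreal_leI)
      with True show ?thesis by simp
    qed (simp add: less_top[symmetric])
  qed
  moreover have fin: "?W < \<infinity>"
    using finite_cost_coupling[OF \<mu> \<nu> eq m] by (auto simp: INF_less_iff)
  ultimately have "ennreal (?D / (b * ?m)) \<le> ennreal (enn2real ?W)"
    by simp
  then have "?D / (b * ?m) \<le> enn2real ?W"
    by (simp add: ennreal_le_iff)
  then show ?thesis
    unfolding wasserstein1_def using b m by (simp add: field_simps)
qed

section \<open>Measures with piecewise constant densities\<close>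

lemma sum_indicator_cell:
  fixes t :: "'i \<Rightarrow> real"
  assumes "finite I" "disjoint_family_on A I" "i \<in> I" "x \<in> A i"
  shows "(\<Sum>l\<in>I. t l * indicator (A l) x) = t i"
proof -
  have "(\<Sum>l\<in>I. t l * indicator (A l) x) = (\<Sum>l\<in>I. if l = i then t i else 0)"
    using assms by (intro sum.cong) (auto simp: disjoint_family_on_def indicator_def)
  then show ?thesis using assms by simp
qed

lemma sum_indicator_no_cell:
  fixes t :: "'i \<Rightarrow> real"
  assumes "x \<notin> (\<Union>i\<in>I. A i)"
  shows "(\<Sum>l\<in>I. t l * indicator (A l) x) = 0"
  using assms by (intro sum.neutral) auto

lemma integral_le_cells:
  fixes h :: "'a::metric_space \<Rightarrow> real"
  assumes \<mu>: "\<mu> \<in> finite_borel_measures" and I: "finite I"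
    and A: "disjoint_family_on A I" "\<And>i. i \<in> I \<Longrightarrow> A i \<in> sets borel"
    and h: "h \<in> borel_measurable borel" "\<And>x. \<bar>h x\<bar> \<le> c"
    and cell: "\<And>i x. i \<in> I \<Longrightarrow> x \<in> A i \<Longrightarrow> h x \<le> t i"
    and rest: "\<And>x. x \<notin> (\<Union>i\<in>I. A i) \<Longrightarrow> h x \<le> s"
  shows "(\<integral>x. h x \<partial>\<mu>) \<le> (\<Sum>i\<in>I. t i * measure \<mu> (A i)) + s * measure \<mu> (- (\<Union>i\<in>I. A i))"
proof -
  note \<mu>' = finite_borel_measuresD[OF \<mu>]
  interpret finite_measure \<mu> by (rule \<mu>')
  let ?R = "- (\<Union>i\<in>I. A i)"
  let ?s = "\<lambda>x. (\<Sum>i\<in>I. t i * indicator (A i) x) + s * indicator ?R x"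
  have "(\<Union>i\<in>I. A i) \<in> sets borel" using A I by (intro sets.finite_UN) auto
  then have R: "?R \<in> sets \<mu>" unfolding \<mu>'(2) by (rule borel_comp)
  have A': "\<And>i. i \<in> I \<Longrightarrow> A i \<in> sets \<mu>" using A(2) \<mu>'(2) by simp
  have int: "integrable \<mu> (\<lambda>x. \<Sum>i\<in>I. t i * indicator (A i) x)" "integrable \<mu> (\<lambda>x. s * indicator ?R x)"
    using A' R by (auto intro!: Bochner_Integration.integrable_sum integrable_mult_right
        simp: integrable_indicator_iff less_top[symmetric])
  have "h x \<le> ?s x" for x
  proof (cases "x \<in> (\<Union>i\<in>I. A i)")
    case True
    then obtain i where "i \<in> I" "x \<in> A i" by blast
    with True show ?thesis using cell sum_indicator_cell[OF I A(1), of i x t] by simp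
  next
    case False
    then show ?thesis using rest[OF False] sum_indicator_no_cell[OF False, of t] by simp
  qed
  then have "(\<integral>x. h x \<partial>\<mu>) \<le> (\<integral>x. ?s x \<partial>\<mu>)"
    using bounded_integrable[OF \<mu> h] int by (intro integral_mono) auto
  also have "\<dots> = (\<Sum>i\<in>I. t i * measure \<mu> (A i)) + s * measure \<mu> ?R"
    using int A' R
    by (subst Bochner_Integration.integral_add[OF int], subst Bochner_Integration.integral_sum)
       (auto simp: \<mu>'(3) integrable_indicator_iff less_top[symmetric] intro!: integrable_mult_right)
  finally show ?thesis .
qed

lemma measure_density_bounded:
  fixes r :: "'a::metric_space \<Rightarrow> real"
  assumes \<mu>: "\<mu> \<in> finite_borel_measures"
    and r: "r \<in> borel_measurable borel" "\<And>x. 0 \<le> r x" "\<And>x. r x \<le> c" and X: "X \<in> sets borel"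
  shows "measure (density \<mu> (\<lambda>x. ennreal (r x))) X = (\<integral>x. r x * indicator X x \<partial>\<mu>)"
proof -
  note [measurable] = r(1) X and \<mu>' = finite_borel_measuresD[OF \<mu>]
  have "emeasure (density \<mu> (\<lambda>x. ennreal (r x))) X = (\<integral>\<^sup>+x. ennreal (r x * indicator X x) \<partial>\<mu>)"
    using \<mu>' r X
    by (subst emeasure_density) (auto intro!: nn_integral_cong simp: indicator_def cong: measurable_cong_sets)
  also have "\<dots> = ennreal (\<integral>x. r x * indicator X x \<partial>\<mu>)"
    using r by (intro nn_integral_eq_integral bounded_integrable[OF \<mu>, of _ c])
      (auto simp: indicator_def order_trans[OF r(2,3)])
  finally show ?thesis
    using r(2) by (simp add: measure_def integral_nonneg_AE)
qed

lemma density_finite_borel_measures: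
  fixes r :: "'a::metric_space \<Rightarrow> real"
  assumes \<mu>: "\<mu> \<in> finite_borel_measures"
    and r: "r \<in> borel_measurable borel" "\<And>x. 0 \<le> r x" "\<And>x. r x \<le> c"
  shows "density \<mu> (\<lambda>x. ennreal (r x)) \<in> finite_borel_measures"
proof -
  note \<mu>' = finite_borel_measuresD[OF \<mu>]
  have int: "integrable \<mu> r"
    using r by (intro bounded_integrable[OF \<mu>, of _ c]) (auto simp: abs_le_iff order_trans[OF _ r(3)] order_trans[OF _ r(2)])
  have "(\<integral>\<^sup>+x. ennreal (r x) \<partial>\<mu>) < \<infinity>"
    using nn_integral_eq_integral[OF int] r(2) by simp
  moreover have "r \<in> borel_measurable \<mu>"
    using r(1) \<mu>' by (simp cong: measurable_cong_sets)
  ultimately have "finite_measure (density \<mu> (\<lambda>x. ennreal (r x)))"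
    using \<mu>'(2,3) by (intro finite_measureI)
      (simp add: emeasure_density less_top[symmetric])
  then show ?thesis
    using \<mu>' by (simp add: finite_borel_measures_def)
qed

text \<open>
  Set by set, \<open>\<mu> - r \<mu>\<close> is dominated by the measure with density \<open>\<bar>1 - r\<bar>\<close>, and the values of that
  measure on the members of a partition add up to its total mass.
\<close>

lemma total_variation_density_le:
  fixes r :: "'a::metric_space \<Rightarrow> real"
  assumes \<mu>: "\<mu> \<in> finite_borel_measures"
    and r: "r \<in> borel_measurable borel" "\<And>x. 0 \<le> r x" "\<And>x. r x \<le> c"
  shows "total_variation (signed_diff \<mu> (density \<mu> (\<lambda>x. ennreal (r x)))) \<le> (\<integral>x. \<bar>1 - r x\<bar> \<partial>\<mu>)"
  unfolding total_variation_def
proof (rule cSUP_least)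
  show "{P. finite P \<and> P \<subseteq> sets borel \<and> disjoint P \<and> \<Union>P = (UNIV :: 'a set)} \<noteq> {}"
    by (auto intro!: exI[of _ "{UNIV}"])
next
  note \<mu>' = finite_borel_measuresD[OF \<mu>]
  interpret finite_measure \<mu> by (rule \<mu>')
  note [measurable] = r(1)
  let ?\<tau> = "density \<mu> (\<lambda>x. ennreal \<bar>1 - r x\<bar>)"
  have dens: "(\<lambda>x. \<bar>1 - r x\<bar>) \<in> borel_measurable borel" "0 \<le> \<bar>1 - r x\<bar>" "\<bar>1 - r x\<bar> \<le> 1 + c" for x
    using r(2,3)[of x] by auto
  fix P assume P: "P \<in> {P. finite P \<and> P \<subseteq> sets borel \<and> disjoint P \<and> \<Union>P = (UNIV :: 'a set)}"
  have "\<bar>signed_diff \<mu> (density \<mu> (\<lambda>x. ennreal (r x))) X\<bar> \<le> measure ?\<tau> X" if "X \<in> P" for X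
  proof -
    have X[measurable]: "X \<in> sets borel" using that P by auto
    have int: "integrable \<mu> (\<lambda>x. r x * indicator X x)"
      using r by (intro bounded_integrable[OF \<mu>, of _ c]) (auto simp: indicator_def order_trans[OF r(2,3)])
    have intX: "integrable \<mu> (indicat_real X)"
      by (intro bounded_integrable[OF \<mu>, of _ 1]) (auto simp: indicator_def)
    have "signed_diff \<mu> (density \<mu> (\<lambda>x. ennreal (r x))) X
        = (\<integral>x. indicator X x \<partial>\<mu>) - (\<integral>x. r x * indicator X x \<partial>\<mu>)"
      by (simp add: signed_diff_def measure_density_bounded[OF \<mu> r X] \<mu>')
    also have "\<dots> = (\<integral>x. (1 - r x) * indicator X x \<partial>\<mu>)"
      using int intX by (simp add: left_diff_distrib)
    also have "\<bar>\<dots>\<bar> \<le> (\<integral>x. \<bar>(1 - r x) * indicator X x\<bar> \<partial>\<mu>)"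
      by (rule integral_abs_bound)
    also have "\<dots> = measure ?\<tau> X"
      by (simp add: measure_density_bounded[OF \<mu> dens X] abs_mult)
    finally show ?thesis .
  qed
  then have "(\<Sum>X\<in>P. \<bar>signed_diff \<mu> (density \<mu> (\<lambda>x. ennreal (r x))) X\<bar>) \<le> (\<Sum>X\<in>P. measure ?\<tau> X)"
    by (rule sum_mono)
  also have "\<dots> = measure ?\<tau> UNIV"
    using P by (intro sum_measure_partition density_finite_borel_measures[OF \<mu> dens]) auto
  also have "\<dots> = (\<integral>x. \<bar>1 - r x\<bar> \<partial>\<mu>)"
    by (simp add: measure_density_bounded[OF \<mu> dens])
  finally show "(\<Sum>X\<in>P. \<bar>signed_diff \<mu> (density \<mu> (\<lambda>x. ennreal (r x))) X\<bar>) \<le> (\<integral>x. \<bar>1 - r x\<bar> \<partial>\<mu>)" .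
qed

text \<open>
  With respect to \<open>\<mu>\<close>, this density gives the cell \<open>A i\<close> the mass \<open>m i\<close>, spread in proportion to \<open>\<mu>\<close>;
  outside the cells it is \<open>0\<close>. The cells in question have positive measure, so the division by
  \<open>measure \<mu> (A i)\<close> is a genuine one.
\<close>

definition cell_density ::
    "'i set \<Rightarrow> ('i \<Rightarrow> 'a set) \<Rightarrow> ('i \<Rightarrow> real) \<Rightarrow> 'a measure \<Rightarrow> 'a \<Rightarrow> real" where
  "cell_density I A m \<mu> x = (\<Sum>i\<in>I. m i / measure \<mu> (A i) * indicator (A i) x)"

lemma cell_density_measurable:
  fixes A :: "'i \<Rightarrow> 'a::metric_space set"
  assumes "\<And>i. i \<in> I \<Longrightarrow> A i \<in> sets borel"
  shows "cell_density I A m \<mu> \<in> borel_measurable borel"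
  unfolding cell_density_def[abs_def] using assms by measurable

lemma cell_density_nonneg:
  assumes "\<And>i. i \<in> I \<Longrightarrow> 0 \<le> m i"
  shows "0 \<le> cell_density I A m \<mu> x"
  unfolding cell_density_def using assms by (intro sum_nonneg) auto

lemma cell_density_le:
  assumes "\<And>i. i \<in> I \<Longrightarrow> 0 \<le> m i"
  shows "cell_density I A m \<mu> x \<le> (\<Sum>i\<in>I. m i / measure \<mu> (A i))"
  unfolding cell_density_def using assms by (intro sum_mono) (auto simp: indicator_def)

lemma cell_density_on_cell:
  assumes "finite I" "disjoint_family_on A I" "i \<in> I" "x \<in> A i"
  shows "cell_density I A m \<mu> x = m i / measure \<mu> (A i)"
  unfolding cell_density_def by (rule sum_indicator_cell[OF assms])

lemma cell_density_off_cells: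
  assumes "x \<notin> (\<Union>i\<in>I. A i)"
  shows "cell_density I A m \<mu> x = 0"
  unfolding cell_density_def by (rule sum_indicator_no_cell[OF assms])

text \<open>
  The integral of \<open>\<bar>1 - r\<bar>\<close> over a cell is exactly the change of its mass, and outside the cells
  \<open>r = 0\<close>, so all of the mass there is lost.
\<close>

lemma total_variation_cell_density_le:
  fixes A :: "'i \<Rightarrow> 'a::metric_space set"
  assumes \<mu>: "\<mu> \<in> finite_borel_measures" and I: "finite I"
    and A: "disjoint_family_on A I" "\<And>i. i \<in> I \<Longrightarrow> A i \<in> sets borel"
      "\<And>i. i \<in> I \<Longrightarrow> 0 < measure \<mu> (A i)"
    and m: "\<And>i. i \<in> I \<Longrightarrow> 0 \<le> m i"
  shows "total_variation (signed_diff \<mu> (density \<mu> (\<lambda>x. ennreal (cell_density I A m \<mu> x))))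
    \<le> (\<Sum>i\<in>I. \<bar>measure \<mu> (A i) - m i\<bar>) + measure \<mu> (- (\<Union>i\<in>I. A i))"
proof -
  let ?r = "cell_density I A m \<mu>"
  have [measurable]: "?r \<in> borel_measurable borel" by (rule cell_density_measurable[OF A(2)])
  have r: "?r \<in> borel_measurable borel" "0 \<le> ?r x" "?r x \<le> (\<Sum>i\<in>I. m i / measure \<mu> (A i))" for x
    using m by (simp_all add: cell_density_nonneg cell_density_le)
  have bound: "\<bar>\<bar>1 - ?r x\<bar>\<bar> \<le> 1 + (\<Sum>i\<in>I. m i / measure \<mu> (A i))" for x
    using r(2,3)[of x] by linarith
  have "total_variation (signed_diff \<mu> (density \<mu> (\<lambda>x. ennreal (?r x)))) \<le> (\<integral>x. \<bar>1 - ?r x\<bar> \<partial>\<mu>)"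
    by (rule total_variation_density_le[OF \<mu> r(1) r(2) r(3)])
  also have "\<dots> \<le> (\<Sum>i\<in>I. \<bar>1 - m i / measure \<mu> (A i)\<bar> * measure \<mu> (A i)) + 1 * measure \<mu> (- (\<Union>i\<in>I. A i))"
    by (rule integral_le_cells[OF \<mu> I A(1,2) _ bound])
       (auto simp: cell_density_on_cell[OF I A(1)] cell_density_off_cells)
  also have "(\<Sum>i\<in>I. \<bar>1 - m i / measure \<mu> (A i)\<bar> * measure \<mu> (A i)) = (\<Sum>i\<in>I. \<bar>measure \<mu> (A i) - m i\<bar>)"
  proof (rule sum.cong[OF refl])
    fix i assume "i \<in> I"
    then have p: "0 < measure \<mu> (A i)" by (rule A(3))
    then have "\<bar>1 - m i / measure \<mu> (A i)\<bar> * measure \<mu> (A i)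
        = \<bar>(1 - m i / measure \<mu> (A i)) * measure \<mu> (A i)\<bar>"
      by (simp add: abs_mult)
    also have "(1 - m i / measure \<mu> (A i)) * measure \<mu> (A i) = measure \<mu> (A i) - m i"
      using p by (simp add: left_diff_distrib)
    finally show "\<bar>1 - m i / measure \<mu> (A i)\<bar> * measure \<mu> (A i) = \<bar>measure \<mu> (A i) - m i\<bar>" .
  qed
  finally show ?thesis by simp
qed

text \<open>
  The density lives on finitely many balls, hence on a bounded set.
\<close>

lemma cell_density_moment:
  fixes A :: "'i \<Rightarrow> 'a::metric_space set"
  assumes \<mu>: "\<mu> \<in> finite_borel_measures" and I: "finite I"
    and A: "\<And>i. i \<in> I \<Longrightarrow> A i \<in> sets borel" "\<And>i. i \<in> I \<Longrightarrow> A i \<subseteq> ball (c i) \<delta>"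
    and m: "\<And>i. i \<in> I \<Longrightarrow> 0 \<le> m i"
  shows "density \<mu> (\<lambda>x. ennreal (cell_density I A m \<mu> x)) \<in> finite_borel_measures1"
proof -
  let ?r = "cell_density I A m \<mu>" and ?\<mu>' = "density \<mu> (\<lambda>x. ennreal (cell_density I A m \<mu> x))"
  have meas: "?r \<in> borel_measurable borel" by (rule cell_density_measurable[OF A(1)])
  have fin: "?\<mu>' \<in> finite_borel_measures"
    by (rule density_finite_borel_measures[OF \<mu> meas cell_density_nonneg[OF m] cell_density_le[OF m]])
  note \<mu>' = finite_borel_measuresD[OF \<mu>] and fin' = finite_borel_measuresD[OF fin]
  interpret F: finite_measure ?\<mu>' by (rule fin')
  fix z :: 'a
  let ?C = "(\<Sum>i\<in>I. dist (c i) z) + \<bar>\<delta>\<bar>"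
  have [measurable]: "?r \<in> borel_measurable \<mu>" "(\<lambda>x. dist x z) \<in> borel_measurable \<mu>"
    using meas \<mu>' by (auto cong: measurable_cong_sets intro!: borel_measurable_continuous_onI continuous_intros)
  have "(\<integral>\<^sup>+x. ennreal (dist x z) \<partial>?\<mu>') = (\<integral>\<^sup>+x. ennreal (?r x) * ennreal (dist x z) \<partial>\<mu>)"
    by (intro nn_integral_density) measurable
  also have "\<dots> \<le> (\<integral>\<^sup>+x. ennreal (?r x) * ennreal ?C \<partial>\<mu>)"
  proof (rule nn_integral_mono)
    fix x
    show "ennreal (?r x) * ennreal (dist x z) \<le> ennreal (?r x) * ennreal ?C"
    proof (cases "x \<in> (\<Union>i\<in>I. A i)")
      case True
      then obtain i where i: "i \<in> I" "x \<in> A i" by blast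
      then have "dist x (c i) < \<delta>" using A(2)[OF i(1)] by (auto simp: dist_commute)
      moreover have "dist (c i) z \<le> (\<Sum>i\<in>I. dist (c i) z)"
        using i I by (intro member_le_sum) auto
      ultimately have "dist x z \<le> ?C" using dist_triangle[of x z "c i"] by linarith
      then show ?thesis by (intro mult_left_mono ennreal_leI) auto
    next
      case False
      then show ?thesis by (simp add: cell_density_off_cells[OF False])
    qed
  qed
  also have "\<dots> = emeasure ?\<mu>' UNIV * ennreal ?C"
    by (subst emeasure_density) (auto simp: nn_integral_multc \<mu>'(2,3))
  also have "\<dots> < \<infinity>"
    by (simp add: F.emeasure_eq_measure ennreal_mult_eq_top_iff less_top[symmetric])
  finally show ?thesis using fin by (auto simp: finite_borel_measures1_def)
qed

definition cell_kernel ::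
    "'i set \<Rightarrow> 'j set \<Rightarrow> ('i \<Rightarrow> 'a set) \<Rightarrow> ('j \<Rightarrow> 'a set) \<Rightarrow> ('i \<Rightarrow> 'j \<Rightarrow> real) \<Rightarrow> 'a \<Rightarrow> 'a \<Rightarrow> real" where
  "cell_kernel I J A B k x y = (\<Sum>i\<in>I. \<Sum>j\<in>J. k i j * (indicator (A i) x * indicator (B j) y))"

lemma cell_kernel_swap: "cell_kernel I J A B k x y = cell_kernel J I B A (\<lambda>j i. k i j) y x"
  unfolding cell_kernel_def by (subst sum.swap) (simp add: mult_ac)

lemma nn_integral_cell_kernel:
  fixes B :: "'j \<Rightarrow> 'a::metric_space set"
  assumes \<nu>: "\<nu> \<in> finite_borel_measures"
    and B: "\<And>j. j \<in> J \<Longrightarrow> B j \<in> sets borel" and k: "\<And>i j. i \<in> I \<Longrightarrow> j \<in> J \<Longrightarrow> 0 \<le> k i j"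
  shows "(\<integral>\<^sup>+y. ennreal (cell_kernel I J A B k x y) \<partial>\<nu>)
    = ennreal (\<Sum>i\<in>I. (\<Sum>j\<in>J. k i j * measure \<nu> (B j)) * indicator (A i) x)"
proof -
  note \<nu>' = finite_borel_measuresD[OF \<nu>]
  interpret finite_measure \<nu> by (rule \<nu>')
  have int: "integrable \<nu> (\<lambda>y. k i j * (indicator (A i) x * indicator (B j) y))" if "j \<in> J" for i j
    using B[OF that] \<nu>' by (intro integrable_mult_right) (auto simp: integrable_indicator_iff less_top[symmetric])
  have "integrable \<nu> (\<lambda>y. cell_kernel I J A B k x y)"
    unfolding cell_kernel_def by (intro Bochner_Integration.integrable_sum int)
  then have "(\<integral>\<^sup>+y. ennreal (cell_kernel I J A B k x y) \<partial>\<nu>) = ennreal (\<integral>y. cell_kernel I J A B k x y \<partial>\<nu>)"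
    using k by (intro nn_integral_eq_integral) (auto simp: cell_kernel_def intro!: sum_nonneg)
  also have "(\<integral>y. cell_kernel I J A B k x y \<partial>\<nu>) = (\<Sum>i\<in>I. \<Sum>j\<in>J. k i j * (indicator (A i) x * measure \<nu> (B j)))"
  proof -
    have "(\<integral>y. cell_kernel I J A B k x y \<partial>\<nu>)
        = (\<Sum>i\<in>I. \<integral>y. (\<Sum>j\<in>J. k i j * (indicator (A i) x * indicator (B j) y)) \<partial>\<nu>)"
      unfolding cell_kernel_def
      by (intro Bochner_Integration.integral_sum Bochner_Integration.integrable_sum int)
    also have "\<dots> = (\<Sum>i\<in>I. \<Sum>j\<in>J. \<integral>y. k i j * (indicator (A i) x * indicator (B j) y) \<partial>\<nu>)"
      by (intro sum.cong refl Bochner_Integration.integral_sum int)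
    also have "\<dots> = (\<Sum>i\<in>I. \<Sum>j\<in>J. k i j * (indicator (A i) x * measure \<nu> (B j)))"
      by (simp add: \<nu>'(3))
    finally show ?thesis .
  qed
  also have "\<dots> = (\<Sum>i\<in>I. (\<Sum>j\<in>J. k i j * measure \<nu> (B j)) * indicator (A i) x)"
    unfolding sum_distrib_right by (intro sum.cong refl) (simp add: mult_ac)
  finally show ?thesis .
qed

lemma cell_kernel_measurable:
  fixes A :: "'i \<Rightarrow> 'a::metric_space set" and B :: "'j \<Rightarrow> 'a set"
  assumes "\<And>i. i \<in> I \<Longrightarrow> A i \<in> sets borel" "\<And>j. j \<in> J \<Longrightarrow> B j \<in> sets borel"
  shows "(\<lambda>p. cell_kernel I J A B k (fst p) (snd p)) \<in> borel_measurable (borel \<Otimes>\<^sub>M borel)"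
  unfolding cell_kernel_def using assms by measurable

section \<open>From a discrete plan to a transport plan\<close>

text \<open>
  A discrete plan \<open>\<pi>\<close> between cells is realised by the measure that has density
  \<open>\<pi> i j / (\<mu>(A i) \<nu>(B j))\<close> on \<open>A i \<times> B j\<close> with respect to \<open>\<mu> \<Otimes>\<^sub>M \<nu>\<close>. By Fubini its marginals are the
  piecewise constant densities with the row and column sums of \<open>\<pi>\<close>. Two points of \<open>A i\<close> and \<open>B j\<close> are
  at most \<open>2 * \<delta>\<close> further apart than the centres of the two cells, which bounds the cost.
\<close>

lemma cell_plan:
  fixes \<mu> \<nu> :: "'a::polish_space measure" and \<pi> :: "'i \<Rightarrow> 'j \<Rightarrow> real"
  assumes \<mu>: "\<mu> \<in> finite_borel_measures" and \<nu>: "\<nu> \<in> finite_borel_measures"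
    and I: "finite I" and J: "finite J"
    and A: "\<And>i. i \<in> I \<Longrightarrow> A i \<in> sets borel" "\<And>i. i \<in> I \<Longrightarrow> 0 < measure \<mu> (A i)"
      "\<And>i. i \<in> I \<Longrightarrow> A i \<subseteq> ball (c i) \<delta>"
    and B: "\<And>j. j \<in> J \<Longrightarrow> B j \<in> sets borel" "\<And>j. j \<in> J \<Longrightarrow> 0 < measure \<nu> (B j)"
      "\<And>j. j \<in> J \<Longrightarrow> B j \<subseteq> ball (d j) \<delta>"
    and \<pi>: "\<And>i j. 0 \<le> \<pi> i j" and \<delta>: "0 < \<delta>"
  defines "\<mu>' \<equiv> density \<mu> (\<lambda>x. ennreal (cell_density I A (\<lambda>i. \<Sum>j\<in>J. \<pi> i j) \<mu> x))"
    and "\<nu>' \<equiv> density \<nu> (\<lambda>y. ennreal (cell_density J B (\<lambda>j. \<Sum>i\<in>I. \<pi> i j) \<nu> y))"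
  shows "measure \<mu>' UNIV = measure \<nu>' UNIV"
    "wasserstein1 \<mu>' \<nu>' \<le> (\<Sum>i\<in>I. \<Sum>j\<in>J. (dist (c i) (d j) + 2 * \<delta>) * \<pi> i j)"
proof -
  note m = finite_borel_measuresD[OF \<mu>] and n = finite_borel_measuresD[OF \<nu>]
  interpret M: finite_measure \<mu> by (rule m)
  interpret N: finite_measure \<nu> by (rule n)
  interpret P: pair_sigma_finite \<mu> \<nu> ..
  have s: "sets (\<mu> \<Otimes>\<^sub>M \<nu>) = sets (borel \<Otimes>\<^sub>M borel)"
    using m n by (intro sets_pair_measure_cong)
  have [measurable]: "fst \<in> borel_measurable (\<mu> \<Otimes>\<^sub>M \<nu>)" "snd \<in> borel_measurable (\<mu> \<Otimes>\<^sub>M \<nu>)"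
    by (simp_all cong: measurable_cong_sets[OF s refl])
  define k where "k i j = \<pi> i j / (measure \<mu> (A i) * measure \<nu> (B j))" for i j
  define w where "w = cell_kernel I J A B k"
  define \<gamma> where "\<gamma> = density (\<mu> \<Otimes>\<^sub>M \<nu>) (\<lambda>p. ennreal (w (fst p) (snd p)))"
  have k: "0 \<le> k i j" for i j using \<pi> by (simp add: k_def)
  have kern: "(\<lambda>p. cell_kernel I J A B l (fst p) (snd p)) \<in> borel_measurable (\<mu> \<Otimes>\<^sub>M \<nu>)" for l
    using cell_kernel_measurable[OF A(1) B(1)] by (simp cong: measurable_cong_sets[OF s refl])
  have [measurable]: "(\<lambda>p. w (fst p) (snd p)) \<in> borel_measurable (\<mu> \<Otimes>\<^sub>M \<nu>)"
    unfolding w_def by (rule kern)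
  have sp: "space (\<mu> \<Otimes>\<^sub>M \<nu>) = UNIV" using m n by (simp add: space_pair_measure)
  have \<gamma>_sets: "sets \<gamma> = sets borel"
    unfolding \<gamma>_def using s by (subst borel_prod[symmetric]) simp
  have row: "(\<Sum>j\<in>J. k i j * measure \<nu> (B j)) = (\<Sum>j\<in>J. \<pi> i j) / measure \<mu> (A i)" for i
    unfolding sum_divide_distrib by (intro sum.cong refl) (use B(2) in \<open>force simp: k_def\<close>)
  have col: "(\<Sum>i\<in>I. k i j * measure \<mu> (A i)) = (\<Sum>i\<in>I. \<pi> i j) / measure \<nu> (B j)" for j
    unfolding sum_divide_distrib by (intro sum.cong refl) (use A(2) in \<open>force simp: k_def\<close>)
  have fst_section: "(\<integral>\<^sup>+y. ennreal (w x y) \<partial>\<nu>) = ennreal (cell_density I A (\<lambda>i. \<Sum>j\<in>J. \<pi> i j) \<mu> x)" for x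
    unfolding w_def cell_density_def row[symmetric] by (rule nn_integral_cell_kernel[OF \<nu> B(1) k])
  have snd_section: "(\<integral>\<^sup>+x. ennreal (w x y) \<partial>\<mu>) = ennreal (cell_density J B (\<lambda>j. \<Sum>i\<in>I. \<pi> i j) \<nu> y)" for y
    unfolding w_def cell_density_def col[symmetric] cell_kernel_swap[of I J]
    by (rule nn_integral_cell_kernel[OF \<mu> A(1) k])
  have dens_A: "cell_density I A l \<mu> \<in> borel_measurable borel" for l
    by (rule cell_density_measurable[OF A(1)])
  have dens_B: "cell_density J B l \<nu> \<in> borel_measurable borel" for l
    by (rule cell_density_measurable[OF B(1)])
  have emeasure_\<gamma>: "emeasure \<gamma> X = (\<integral>\<^sup>+p. ennreal (w (fst p) (snd p)) * indicator X p \<partial>(\<mu> \<Otimes>\<^sub>M \<nu>))"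
    if "X \<in> sets (\<mu> \<Otimes>\<^sub>M \<nu>)" for X
    unfolding \<gamma>_def using that by (intro emeasure_density) auto
  have fst_marginal: "distr \<gamma> borel fst = \<mu>'"
  proof (rule measure_eqI)
    show "sets (distr \<gamma> borel fst) = sets \<mu>'" using m by (simp add: \<mu>'_def)
    fix X assume "X \<in> sets (distr \<gamma> borel fst)"
    then have X: "X \<in> sets borel" by simp
    then have X': "X \<in> sets \<mu>" using m by simp
    have pre: "fst -` X = X \<times> space \<nu>" using n by auto
    have "emeasure (distr \<gamma> borel fst) X = emeasure \<gamma> (X \<times> space \<nu>)"
      using X product_borel_measureD[OF \<gamma>_sets] by (subst emeasure_distr) (auto simp: pre)
    also have "\<dots> = (\<integral>\<^sup>+x. \<integral>\<^sup>+y. ennreal (w x y) * indicator X x \<partial>\<nu> \<partial>\<mu>)"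
      using X' by (subst emeasure_\<gamma>, simp, subst N.nn_integral_fst[symmetric])
        (auto intro!: nn_integral_cong simp: indicator_def)
    also have "\<dots> = (\<integral>\<^sup>+x. ennreal (cell_density I A (\<lambda>i. \<Sum>j\<in>J. \<pi> i j) \<mu> x) * indicator X x \<partial>\<mu>)"
      by (intro nn_integral_cong) (auto simp: indicator_def fst_section)
    also have "\<dots> = emeasure \<mu>' X"
      unfolding \<mu>'_def using X' dens_A
      by (subst emeasure_density) (auto cong: measurable_cong_sets[OF m(2) refl])
    finally show "emeasure (distr \<gamma> borel fst) X = emeasure \<mu>' X" .
  qed
  have snd_marginal: "distr \<gamma> borel snd = \<nu>'"
  proof (rule measure_eqI)
    show "sets (distr \<gamma> borel snd) = sets \<nu>'" using n by (simp add: \<nu>'_def)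
    fix X assume "X \<in> sets (distr \<gamma> borel snd)"
    then have X: "X \<in> sets borel" by simp
    then have X': "X \<in> sets \<nu>" using n by simp
    have pre: "snd -` X = space \<mu> \<times> X" using m by auto
    have "emeasure (distr \<gamma> borel snd) X = emeasure \<gamma> (space \<mu> \<times> X)"
      using X product_borel_measureD[OF \<gamma>_sets] by (subst emeasure_distr) (auto simp: pre)
    also have "\<dots> = (\<integral>\<^sup>+y. \<integral>\<^sup>+x. ennreal (w x y) * indicator X y \<partial>\<mu> \<partial>\<nu>)"
      using X' by (subst emeasure_\<gamma>, simp, subst P.nn_integral_snd[symmetric])
        (auto intro!: nn_integral_cong simp: indicator_def)
    also have "\<dots> = (\<integral>\<^sup>+y. ennreal (cell_density J B (\<lambda>j. \<Sum>i\<in>I. \<pi> i j) \<nu> y) * indicator X y \<partial>\<nu>)"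
      by (intro nn_integral_cong) (auto simp: indicator_def snd_section)
    also have "\<dots> = emeasure \<nu>' X"
      unfolding \<nu>'_def using X' dens_B
      by (subst emeasure_density) (auto cong: measurable_cong_sets[OF n(2) refl])
    finally show "emeasure (distr \<gamma> borel snd) X = emeasure \<nu>' X" .
  qed
  have fin: "\<mu>' \<in> finite_borel_measures"
    unfolding \<mu>'_def
    by (rule density_finite_borel_measures[OF \<mu> cell_density_measurable[OF A(1)] cell_density_nonneg cell_density_le])
       (auto intro: sum_nonneg \<pi>)
  have mass: "emeasure \<gamma> UNIV = emeasure \<mu>' UNIV" "emeasure \<gamma> UNIV = emeasure \<nu>' UNIV"
    using product_borel_measureD[OF \<gamma>_sets]
    by (simp_all add: fst_marginal[symmetric] snd_marginal[symmetric] emeasure_distr)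
  then show "measure \<mu>' UNIV = measure \<nu>' UNIV" by (simp add: measure_def)
  have \<gamma>_fin: "finite_measure \<gamma>"
    using finite_borel_measuresD[OF fin] finite_measure.emeasure_finite[of \<mu>' UNIV]
    by (intro finite_measureI) (simp add: product_borel_measureD[OF \<gamma>_sets] mass)
  let ?k = "\<lambda>i j. k i j * (dist (c i) (d j) + 2 * \<delta>)"
  have k': "0 \<le> ?k i j" for i j using k \<delta> by auto
  have cost_le: "w x y * dist x y \<le> cell_kernel I J A B ?k x y" for x y
    unfolding w_def cell_kernel_def sum_distrib_right
  proof (intro sum_mono)
    fix i j assume ij: "i \<in> I" "j \<in> J"
    show "k i j * (indicator (A i) x * indicator (B j) y) * dist x y
        \<le> ?k i j * (indicator (A i) x * indicator (B j) y)"
    proof (cases "x \<in> A i \<and> y \<in> B j")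
      case True
      then have "dist (c i) x < \<delta>" "dist (d j) y < \<delta>" using ij A(3) B(3) by force+
      then have "dist x y \<le> dist (c i) (d j) + 2 * \<delta>"
        using dist_triangle[of x y "c i"] dist_triangle[of "c i" y "d j"] by (simp add: dist_commute)
      then show ?thesis using True k by (simp add: mult_left_mono)
    qed auto
  qed
  have "(\<integral>\<^sup>+p. ennreal (dist (fst p) (snd p)) \<partial>\<gamma>)
      = (\<integral>\<^sup>+p. ennreal (w (fst p) (snd p)) * ennreal (dist (fst p) (snd p)) \<partial>(\<mu> \<Otimes>\<^sub>M \<nu>))"
    unfolding \<gamma>_def by (intro nn_integral_density) measurable
  also have "\<dots> \<le> (\<integral>\<^sup>+p. ennreal (cell_kernel I J A B ?k (fst p) (snd p)) \<partial>(\<mu> \<Otimes>\<^sub>M \<nu>))"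
    by (intro nn_integral_mono) (simp add: ennreal_mult''[symmetric] ennreal_leI cost_le)
  also have "\<dots> = (\<integral>\<^sup>+x. \<integral>\<^sup>+y. ennreal (cell_kernel I J A B ?k x y) \<partial>\<nu> \<partial>\<mu>)"
    using kern by (subst N.nn_integral_fst[symmetric]) auto
  also have "\<dots> = (\<integral>\<^sup>+x. ennreal (\<Sum>i\<in>I. (\<Sum>j\<in>J. ?k i j * measure \<nu> (B j)) * indicator (A i) x) \<partial>\<mu>)"
    by (simp add: nn_integral_cell_kernel[OF \<nu> B(1) k'])
  also have "\<dots> = ennreal (\<integral>x. (\<Sum>i\<in>I. (\<Sum>j\<in>J. ?k i j * measure \<nu> (B j)) * indicator (A i) x) \<partial>\<mu>)"
    using k \<delta> A(1) m
    by (intro nn_integral_eq_integral Bochner_Integration.integrable_sum integrable_mult_right)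
       (auto simp: integrable_indicator_iff less_top[symmetric] intro!: AE_I2 sum_nonneg mult_nonneg_nonneg)
  also have "(\<integral>x. (\<Sum>i\<in>I. (\<Sum>j\<in>J. ?k i j * measure \<nu> (B j)) * indicator (A i) x) \<partial>\<mu>)
      = (\<Sum>i\<in>I. (\<Sum>j\<in>J. ?k i j * measure \<nu> (B j)) * measure \<mu> (A i))"
    using A(1) m
    by (subst Bochner_Integration.integral_sum)
       (auto simp: integrable_indicator_iff less_top[symmetric] intro!: integrable_mult_right)
  also have "\<dots> = (\<Sum>i\<in>I. \<Sum>j\<in>J. (dist (c i) (d j) + 2 * \<delta>) * \<pi> i j)"
    unfolding sum_distrib_right
    by (intro sum.cong refl) (use A(2) B(2) in \<open>force simp: k_def\<close>)
  finally have cost: "(\<integral>\<^sup>+p. ennreal (dist (fst p) (snd p)) \<partial>\<gamma>)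
    \<le> ennreal (\<Sum>i\<in>I. \<Sum>j\<in>J. (dist (c i) (d j) + 2 * \<delta>) * \<pi> i j)" .
  show "wasserstein1 \<mu>' \<nu>' \<le> (\<Sum>i\<in>I. \<Sum>j\<in>J. (dist (c i) (d j) + 2 * \<delta>) * \<pi> i j)"
    unfolding fst_marginal[symmetric] snd_marginal[symmetric]
    using \<pi> \<delta> by (intro wasserstein1_le_plan_cost[OF \<gamma>_sets \<gamma>_fin cost] sum_nonneg mult_nonneg_nonneg) auto
qed

section \<open>Cells and potentials\<close>

lemma separable_cells:
  assumes "0 < \<delta>"
  obtains A :: "nat \<Rightarrow> 'a::{metric_space, second_countable_topology} set" and c :: "nat \<Rightarrow> 'a"
  where "disjoint_family A" "\<And>i. A i \<in> sets borel" "\<And>i. A i \<subseteq> ball (c i) \<delta>" "(\<Union>i. A i) = UNIV"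
proof -
  obtain D :: "'a set" where D: "countable D" "\<And>X. open X \<Longrightarrow> X \<noteq> {} \<Longrightarrow> \<exists>d\<in>D. d \<in> X"
    using countable_dense_setE by blast
  then have "D \<noteq> {}" using D(2)[of UNIV] by auto
  define c where "c = from_nat_into D"
  let ?A = "disjointed (\<lambda>i. ball (c i) \<delta>)"
  show thesis
  proof (rule that[of ?A c])
    show "disjoint_family ?A" by (rule disjoint_family_disjointed)
    show "?A i \<in> sets borel" for i
    proof -
      have "range (\<lambda>i. ball (c i) \<delta>) \<subseteq> sets borel" by auto
      then show ?thesis using sets.range_disjointed_sets by blast
    qed
    show "?A i \<subseteq> ball (c i) \<delta>" for i by (rule disjointed_subset)
    have "x \<in> (\<Union>i. ball (c i) \<delta>)" for x
    proof -
      obtain d where d: "d \<in> D" "d \<in> ball x \<delta>"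
        using D(2)[of "ball x \<delta>"] assms by auto
      then obtain i where "c i = d"
        using from_nat_into_surj[OF D(1)] by (auto simp: c_def)
      with d show ?thesis by (auto simp: dist_commute)
    qed
    then show "(\<Union>i. ?A i) = UNIV" by (auto simp: UN_disjointed_eq)
  qed
qed

text \<open>
  Finitely many cells carry all but \<open>\<delta>\<close> of the mass, by countable additivity.
  Cells of measure \<open>0\<close> are left out since densities divide by their measure.
\<close>

lemma finitely_many_cells:
  fixes \<mu> :: "'a::metric_space measure" and A :: "nat \<Rightarrow> 'a set"
  assumes \<mu>: "\<mu> \<in> finite_borel_measures"
    and A: "disjoint_family A" "\<And>i. A i \<in> sets borel" "(\<Union>i. A i) = UNIV" and \<delta>: "0 < \<delta>"
  obtains I where "finite I" "\<And>i. i \<in> I \<Longrightarrow> 0 < measure \<mu> (A i)"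
    "measure \<mu> (- (\<Union>i\<in>I. A i)) \<le> \<delta>" "(\<Sum>i\<in>I. measure \<mu> (A i)) \<le> measure \<mu> UNIV"
proof -
  note \<mu>' = finite_borel_measuresD[OF \<mu>]
  interpret finite_measure \<mu> by (rule \<mu>')
  have "(\<lambda>i. measure \<mu> (A i)) sums measure \<mu> (\<Union>i. A i)"
    using A \<mu>' by (intro finite_measure_UNION) auto
  then have "(\<lambda>n. \<Sum>i<n. measure \<mu> (A i)) \<longlonglongrightarrow> measure \<mu> UNIV"
    using A(3) by (simp add: sums_def)
  then obtain n where n: "\<bar>(\<Sum>i<n. measure \<mu> (A i)) - measure \<mu> UNIV\<bar> < \<delta>"
    using \<delta> by (auto dest!: LIMSEQ_D)
  define I where "I = {i \<in> {..<n}. 0 < measure \<mu> (A i)}"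
  have fin: "finite I" by (simp add: I_def)
  have "(\<Sum>i\<in>I. measure \<mu> (A i)) = (\<Sum>i<n. measure \<mu> (A i))"
    unfolding I_def by (intro sum.mono_neutral_left) (auto simp: zero_less_measure_iff)
  moreover have un: "measure \<mu> (\<Union>i\<in>I. A i) = (\<Sum>i\<in>I. measure \<mu> (A i))"
    using A \<mu>' fin by (intro finite_measure_finite_Union) (auto simp: disjoint_family_on_def)
  moreover have "measure \<mu> (- (\<Union>i\<in>I. A i)) = measure \<mu> UNIV - measure \<mu> (\<Union>i\<in>I. A i)"
    using finite_measure_compl[of "\<Union>i\<in>I. A i"] A(2) \<mu>' fin by (auto simp: Compl_eq_Diff_UNIV)
  moreover have "measure \<mu> (\<Union>i\<in>I. A i) \<le> measure \<mu> UNIV"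
    using \<mu>' by (intro finite_measure_mono) auto
  ultimately show thesis
    using n fin by (intro that[of I]) (auto simp: I_def)
qed

text \<open>
  The function \<open>min\<^sub>j (b * dist x (d j) - g j)\<close>, truncated to \<open>[- a, a]\<close>, is the largest
  \<open>b\<close>-Lipschitz function with values in \<open>[- a, a]\<close> and \<open>h (d j) \<le> - g j\<close>; the last conclusion is this
  maximality at a single point. It turns the constraints \<open>f i + g j \<le> b * dist\<close> of a pair of potentials
  into \<open>f i \<le> h\<close> at the sources, so that the single function \<open>h\<close> has at least the dual value of
  \<open>(f, g)\<close>. Including \<open>a\<close> among the values of which the minimum is taken performs the upper
  truncation and keeps the minimum defined for empty \<open>J\<close>.
\<close>

lemma lipschitz_potential:
  fixes d :: "'j \<Rightarrow> 'a::metric_space" and g :: "'j \<Rightarrow> real"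
  assumes J: "finite J" and a: "0 \<le> a" and b: "0 \<le> b" and g: "\<And>j. j \<in> J \<Longrightarrow> g j \<le> a"
  obtains h where "\<And>x. \<bar>h x\<bar> \<le> a" "\<And>x y. \<bar>h x - h y\<bar> \<le> b * dist x y"
    "\<And>j x. j \<in> J \<Longrightarrow> h x \<le> b * dist x (d j) - g j"
    "\<And>t x. t \<le> a \<Longrightarrow> (\<And>j. j \<in> J \<Longrightarrow> t \<le> b * dist x (d j) - g j) \<Longrightarrow> t \<le> h x"
proof -
  define S where "S x = insert a ((\<lambda>j. b * dist x (d j) - g j) ` J)" for x
  define h where "h x = max (- a) (Min (S x))" for x
  have S: "finite (S x)" "S x \<noteq> {}" for x using J by (auto simp: S_def)
  have Min_le: "Min (S x) \<le> s" if "s \<in> S x" for s x using S that by simp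
  have Min_Lip: "Min (S x) \<le> Min (S y) + b * dist x y" for x y
  proof -
    have "Min (S y) \<in> S y" using S by (rule Min_in)
    then consider "Min (S y) = a" | j where "j \<in> J" "Min (S y) = b * dist y (d j) - g j"
      by (auto simp: S_def)
    then show ?thesis
    proof cases
      case 1
      moreover have "Min (S x) \<le> a" by (rule Min_le) (simp add: S_def)
      ultimately show ?thesis using b by (simp add: add_increasing2)
    next
      case (2 j)
      have "Min (S x) \<le> b * dist x (d j) - g j" using 2 by (intro Min_le) (auto simp: S_def)
      moreover have "b * dist x (d j) \<le> b * (dist x y + dist y (d j))"
        using b by (intro mult_left_mono dist_triangle)
      ultimately show ?thesis using 2 by (simp add: distrib_left)
    qed
  qed
  show thesis
  proof (rule that[of h])
    show "\<bar>h x\<bar> \<le> a" for x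
      using a Min_le[of a x] by (auto simp: h_def S_def)
    have h_Lip: "h x \<le> h y + b * dist x y" for x y
      using Min_Lip[of x y] mult_nonneg_nonneg[OF b zero_le_dist[of x y]] unfolding h_def by linarith
    show "\<bar>h x - h y\<bar> \<le> b * dist x y" for x y
      using h_Lip[of x y] h_Lip[of y x] by (simp add: dist_commute abs_le_iff)
    show "h x \<le> b * dist x (d j) - g j" if "j \<in> J" for j x
    proof -
      have "Min (S x) \<le> b * dist x (d j) - g j" using that by (intro Min_le) (auto simp: S_def)
      moreover have "- a \<le> b * dist x (d j) - g j"
        using g[OF that] mult_nonneg_nonneg[OF b zero_le_dist[of x "d j"]] by linarith
      ultimately show ?thesis by (simp add: h_def)
    qed
    show "t \<le> h x" if "t \<le> a" "\<And>j. j \<in> J \<Longrightarrow> t \<le> b * dist x (d j) - g j" for t x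
    proof -
      have "t \<le> Min (S x)" using S that by (auto simp: S_def)
      then show ?thesis by (simp add: h_def)
    qed
  qed
qed

lemma wasserstein1_nonneg: "0 \<le> wasserstein1 \<mu> \<nu>"
  by (simp add: wasserstein1_def)

section \<open>The two inequalities\<close>

lemma gen_wasserstein_le:
  fixes \<mu> \<nu> \<mu>' \<nu>' :: "'a::metric_space measure"
  assumes ab: "0 \<le> a" "0 \<le> b"
    and \<mu>: "\<mu> \<in> finite_borel_measures" and \<nu>: "\<nu> \<in> finite_borel_measures"
    and \<mu>': "\<mu>' \<in> finite_borel_measures1" and \<nu>': "\<nu>' \<in> finite_borel_measures1"
    and eq: "measure \<mu>' UNIV = measure \<nu>' UNIV"
  shows "gen_wasserstein a b \<mu> \<nu> \<le> a * total_variation (signed_diff \<mu> \<mu>')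
    + a * total_variation (signed_diff \<nu> \<nu>') + b * wasserstein1 \<mu>' \<nu>'"
  unfolding gen_wasserstein_def
proof (rule cInf_lower)
  show "bdd_below {a * total_variation (signed_diff \<mu> \<mu>') + a * total_variation (signed_diff \<nu> \<nu>')
            + b * wasserstein1 \<mu>' \<nu>' |\<mu>' \<nu>'.
          \<mu>' \<in> finite_borel_measures1 \<and> \<nu>' \<in> finite_borel_measures1 \<and>
          measure \<mu>' UNIV = measure \<nu>' UNIV}"
    using ab \<mu> \<nu>
    by (intro bdd_belowI[of _ 0])
       (auto simp: finite_borel_measures1_def
         intro!: add_nonneg_nonneg mult_nonneg_nonneg total_variation_nonneg wasserstein1_nonneg)
qed (use \<mu>' \<nu>' eq in blast)

text \<open>
  Discretise both measures on cells of radius \<open>\<delta>\<close> and solve the finite problem with price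
  \<open>b * (dist + 2 * \<delta>)\<close> for the masses of the cells. Its plan gives admissible \<open>\<mu>'\<close> and \<open>\<nu>'\<close> whose
  cost exceeds the finite value by at most \<open>a\<close> per unit of mass outside the cells; its potentials give a test function \<open>h\<close>
  that loses at most \<open>3 * b * \<delta>\<close> per unit of mass on the cells, and \<open>a\<close> per unit outside. The
  constant in the conclusion collects these errors.
\<close>

lemma almost_optimal_test_function:
  fixes a b :: real and \<mu> \<nu> :: "'a::polish_space measure"
  assumes a: "0 < a" and b: "0 < b"
    and \<mu>: "\<mu> \<in> finite_borel_measures" and \<nu>: "\<nu> \<in> finite_borel_measures"
    and \<delta>: "0 < \<delta>"
  shows "\<exists>f\<in>test_functions a b. gen_wasserstein a b \<mu> \<nu>
    \<le> integral_signed_diff \<mu> \<nu> (apply_bcontfun f)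
      + \<delta> * (1 + 4 * a + 3 * b * measure \<mu> UNIV + 3 * b * measure \<nu> UNIV)"
proof -
  obtain A :: "nat \<Rightarrow> 'a set" and c where A: "disjoint_family A" "\<And>i. A i \<in> sets borel"
      "\<And>i. A i \<subseteq> ball (c i) \<delta>" "(\<Union>i. A i) = UNIV"
    using separable_cells[OF \<delta>] by blast
  obtain I where I: "finite I" "\<And>i. i \<in> I \<Longrightarrow> 0 < measure \<mu> (A i)"
      "measure \<mu> (- (\<Union>i\<in>I. A i)) \<le> \<delta>" "(\<Sum>i\<in>I. measure \<mu> (A i)) \<le> measure \<mu> UNIV"
    using finitely_many_cells[OF \<mu> A(1,2,4) \<delta>] by blast
  obtain J where J: "finite J" "\<And>j. j \<in> J \<Longrightarrow> 0 < measure \<nu> (A j)"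
      "measure \<nu> (- (\<Union>j\<in>J. A j)) \<le> \<delta>" "(\<Sum>j\<in>J. measure \<nu> (A j)) \<le> measure \<nu> UNIV"
    using finitely_many_cells[OF \<nu> A(1,2,4) \<delta>] by blast
  have dis: "disjoint_family_on A K" for K
    using A(1) by (rule disjoint_family_on_mono[rotated]) simp
  obtain \<pi> f g where \<pi>: "\<And>i j. 0 \<le> \<pi> i j"
    and f: "\<And>i. i \<in> I \<Longrightarrow> \<bar>f i\<bar> \<le> a" and g: "\<And>j. j \<in> J \<Longrightarrow> \<bar>g j\<bar> \<le> a"
    and fg: "\<And>i j. i \<in> I \<Longrightarrow> j \<in> J \<Longrightarrow> f i + g j \<le> b * (dist (c i) (c j) + 2 * \<delta>)"
    and val: "a * (\<Sum>i\<in>I. \<bar>measure \<mu> (A i) - (\<Sum>j\<in>J. \<pi> i j)\<bar>)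
        + a * (\<Sum>j\<in>J. \<bar>measure \<nu> (A j) - (\<Sum>i\<in>I. \<pi> i j)\<bar>)
        + (\<Sum>i\<in>I. \<Sum>j\<in>J. b * (dist (c i) (c j) + 2 * \<delta>) * \<pi> i j)
      \<le> (\<Sum>i\<in>I. f i * measure \<mu> (A i)) + (\<Sum>j\<in>J. g j * measure \<nu> (A j)) + \<delta>"
    using finite_transport_duality[OF I(1) J(1), of a "\<lambda>i j. b * (dist (c i) (c j) + 2 * \<delta>)" \<delta>
        "\<lambda>i. measure \<mu> (A i)" "\<lambda>j. measure \<nu> (A j)"] a b \<delta>
    by (auto simp del: sum.cong)
  obtain h where h: "\<And>x. \<bar>h x\<bar> \<le> a" "\<And>x y. \<bar>h x - h y\<bar> \<le> b * dist x y"
    and h_le: "\<And>j x. j \<in> J \<Longrightarrow> h x \<le> b * dist x (c j) - g j"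
    and h_ge: "\<And>t x. t \<le> a \<Longrightarrow> (\<And>j. j \<in> J \<Longrightarrow> t \<le> b * dist x (c j) - g j) \<Longrightarrow> t \<le> h x"
    using lipschitz_potential[OF J(1), of a b g c] a b g by (auto simp: abs_le_iff)
  have b\<delta>: "0 < b * \<delta>" "3 * b * \<delta> = 3 * (b * \<delta>)" using b \<delta> by simp_all
  have near: "b * dist x (c i) \<le> b * \<delta>" if "x \<in> A i" for x i
    using that A(3)[of i] b by (intro mult_left_mono) (auto simp: dist_commute)
  have h_near_ge: "f i - 3 * b * \<delta> \<le> h x" if i: "i \<in> I" and x: "x \<in> A i" for i x
  proof (rule h_ge)
    show "f i - 3 * b * \<delta> \<le> a" using f[OF i] b\<delta> by linarith
    fix j assume "j \<in> J"
    \<comment> \<open>Two of the three \<open>b * \<delta>\<close> come from the price, the third from the distance between \<open>x\<close> and \<open>c i\<close>.\<close>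
    have "b * dist (c i) (c j) \<le> b * (dist x (c i) + dist x (c j))"
      using b by (intro mult_left_mono dist_triangle3) auto
    with fg[OF i \<open>j \<in> J\<close>] near[OF x]
    show "f i - 3 * b * \<delta> \<le> b * dist x (c j) - g j" by (simp add: distrib_left)
  qed
  have h_near_le: "h x \<le> 3 * b * \<delta> - g j" if "j \<in> J" "x \<in> A j" for j x
    using h_le[OF that(1), of x] near[OF that(2)] b\<delta> by linarith
  have cont: "continuous_on UNIV h"
  proof (rule lipschitz_on_continuous_on[of b])
    show "b-lipschitz_on UNIV h"
      using b h(2) by (intro lipschitz_onI) (auto simp: dist_real_def)
  qed
  then have meas: "h \<in> borel_measurable borel" by (rule borel_measurable_continuous_onI)
  have "h \<in> bcontfun" using h(1) by (intro bcontfun_normI[OF cont, of a]) simp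
  then have Bcontfun_h: "apply_bcontfun (Bcontfun h) = h" by (rule Bcontfun_inverse)
  have test: "Bcontfun h \<in> test_functions a b"
    using b h by (simp add: test_functions_iff Bcontfun_h)
  \<comment> \<open>One estimate for both measures: it is used with \<open>u = h\<close> for \<open>\<mu>\<close> and with \<open>u = - h\<close> for \<open>\<nu>\<close>.\<close>
  have lower: "(\<Sum>i\<in>K. t i * measure \<rho> (A i)) - \<delta> * (a + 3 * b * measure \<rho> UNIV) \<le> (\<integral>x. u x \<partial>\<rho>)"
    if \<rho>: "\<rho> \<in> finite_borel_measures" and K: "finite K"
      and small: "measure \<rho> (- (\<Union>i\<in>K. A i)) \<le> \<delta>" "(\<Sum>i\<in>K. measure \<rho> (A i)) \<le> measure \<rho> UNIV"
      and u: "u \<in> borel_measurable borel" "\<And>x. \<bar>u x\<bar> \<le> a"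
      and ge: "\<And>i x. i \<in> K \<Longrightarrow> x \<in> A i \<Longrightarrow> t i - 3 * b * \<delta> \<le> u x" for \<rho> K t u
  proof -
    have ge': "- u x \<le> 3 * b * \<delta> - t i" if "i \<in> K" "x \<in> A i" for i x
      using ge[OF that] by simp
    have "(\<integral>x. - u x \<partial>\<rho>) \<le> (\<Sum>i\<in>K. (3 * b * \<delta> - t i) * measure \<rho> (A i)) + a * measure \<rho> (- (\<Union>i\<in>K. A i))"
      using u ge' by (intro integral_le_cells[OF \<rho> K dis A(2), where c = a])
        (auto simp: abs_le_iff minus_le_iff)
    also have "(\<Sum>i\<in>K. (3 * b * \<delta> - t i) * measure \<rho> (A i))
        = 3 * b * \<delta> * (\<Sum>i\<in>K. measure \<rho> (A i)) - (\<Sum>i\<in>K. t i * measure \<rho> (A i))"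
      by (simp add: left_diff_distrib sum_subtractf sum_distrib_left)
    finally have "(\<Sum>i\<in>K. t i * measure \<rho> (A i)) \<le> (\<integral>x. u x \<partial>\<rho>)
        + 3 * b * \<delta> * (\<Sum>i\<in>K. measure \<rho> (A i)) + a * measure \<rho> (- (\<Union>i\<in>K. A i))"
      by simp
    moreover have "3 * b * \<delta> * (\<Sum>i\<in>K. measure \<rho> (A i)) \<le> 3 * b * \<delta> * measure \<rho> UNIV"
      using b \<delta> small by (intro mult_left_mono) auto
    moreover have "a * measure \<rho> (- (\<Union>i\<in>K. A i)) \<le> a * \<delta>"
      using a small by (intro mult_left_mono) auto
    ultimately show ?thesis by (simp add: algebra_simps)
  qed
  have dual_\<mu>: "(\<Sum>i\<in>I. f i * measure \<mu> (A i)) - \<delta> * (a + 3 * b * measure \<mu> UNIV) \<le> (\<integral>x. h x \<partial>\<mu>)"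
    by (rule lower[OF \<mu> I(1,3,4) meas h(1) h_near_ge])
  have dual_\<nu>: "(\<Sum>j\<in>J. g j * measure \<nu> (A j)) - \<delta> * (a + 3 * b * measure \<nu> UNIV) \<le> (\<integral>x. - h x \<partial>\<nu>)"
  proof (rule lower[OF \<nu> J(1,3,4)])
    show "g j - 3 * b * \<delta> \<le> - h x" if "j \<in> J" "x \<in> A j" for j x
      using h_near_le[OF that] by simp
  qed (use meas h(1) in auto)
  define \<mu>' where "\<mu>' = density \<mu> (\<lambda>x. ennreal (cell_density I A (\<lambda>i. \<Sum>j\<in>J. \<pi> i j) \<mu> x))"
  define \<nu>' where "\<nu>' = density \<nu> (\<lambda>y. ennreal (cell_density J A (\<lambda>j. \<Sum>i\<in>I. \<pi> i j) \<nu> y))"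
  have plan: "measure \<mu>' UNIV = measure \<nu>' UNIV"
      "wasserstein1 \<mu>' \<nu>' \<le> (\<Sum>i\<in>I. \<Sum>j\<in>J. (dist (c i) (c j) + 2 * \<delta>) * \<pi> i j)"
    unfolding \<mu>'_def \<nu>'_def
    using cell_plan[of \<mu> \<nu> I J A c \<delta> A c \<pi>, OF \<mu> \<nu> I(1) J(1) A(2) I(2) A(3) A(2) J(2) A(3) \<pi> \<delta>]
    by blast+
  have "\<mu>' \<in> finite_borel_measures1" "\<nu>' \<in> finite_borel_measures1"
    unfolding \<mu>'_def \<nu>'_def
    by (rule cell_density_moment[OF _ _ A(2,3)]; use \<mu> \<nu> I J \<pi> in \<open>auto intro: sum_nonneg\<close>)+
  then have "gen_wasserstein a b \<mu> \<nu> \<le> a * total_variation (signed_diff \<mu> \<mu>')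
      + a * total_variation (signed_diff \<nu> \<nu>') + b * wasserstein1 \<mu>' \<nu>'"
    using a b by (intro gen_wasserstein_le \<mu> \<nu> plan(1)) auto
  also have "\<dots> \<le> a * ((\<Sum>i\<in>I. \<bar>measure \<mu> (A i) - (\<Sum>j\<in>J. \<pi> i j)\<bar>) + \<delta>)
      + a * ((\<Sum>j\<in>J. \<bar>measure \<nu> (A j) - (\<Sum>i\<in>I. \<pi> i j)\<bar>) + \<delta>)
      + b * (\<Sum>i\<in>I. \<Sum>j\<in>J. (dist (c i) (c j) + 2 * \<delta>) * \<pi> i j)"
  proof (intro add_mono mult_left_mono plan(2))
    show "total_variation (signed_diff \<mu> \<mu>') \<le> (\<Sum>i\<in>I. \<bar>measure \<mu> (A i) - (\<Sum>j\<in>J. \<pi> i j)\<bar>) + \<delta>"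
      using total_variation_cell_density_le[OF \<mu> I(1) dis A(2) I(2), of "\<lambda>i. \<Sum>j\<in>J. \<pi> i j"] \<pi> I(3)
      unfolding \<mu>'_def by (simp add: sum_nonneg)
    show "total_variation (signed_diff \<nu> \<nu>') \<le> (\<Sum>j\<in>J. \<bar>measure \<nu> (A j) - (\<Sum>i\<in>I. \<pi> i j)\<bar>) + \<delta>"
      using total_variation_cell_density_le[OF \<nu> J(1) dis A(2) J(2), of "\<lambda>j. \<Sum>i\<in>I. \<pi> i j"] \<pi> J(3)
      unfolding \<nu>'_def by (simp add: sum_nonneg)
  qed (use a b in auto)
  also have "\<dots> \<le> (\<Sum>i\<in>I. f i * measure \<mu> (A i)) + (\<Sum>j\<in>J. g j * measure \<nu> (A j)) + \<delta> + 2 * a * \<delta>"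
  proof -
    have "(\<Sum>i\<in>I. \<Sum>j\<in>J. b * (dist (c i) (c j) + 2 * \<delta>) * \<pi> i j)
        = b * (\<Sum>i\<in>I. \<Sum>j\<in>J. (dist (c i) (c j) + 2 * \<delta>) * \<pi> i j)"
      by (simp only: sum_distrib_left mult.assoc)
    then show ?thesis using val by (simp add: distrib_left[of a])
  qed
  also have "\<dots> \<le> integral_signed_diff \<mu> \<nu> h
      + \<delta> * (1 + 4 * a + 3 * b * measure \<mu> UNIV + 3 * b * measure \<nu> UNIV)"
    using dual_\<mu> dual_\<nu> by (simp add: integral_signed_diff_def algebra_simps)
  finally show ?thesis using test Bcontfun_h by (intro bexI[of _ "Bcontfun h"]) auto
qed

text \<open>
  Write \<open>\<mu> - \<nu> = (\<mu> - \<mu>') + (\<mu>' - \<nu>') + (\<nu>' - \<nu>)\<close>: the bound \<open>a\<close> on \<open>f\<close> controls the outer two terms,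
  the Lipschitz constant the middle one.
\<close>

lemma integral_signed_diff_le_decomposition:
  fixes \<mu> \<nu> \<mu>' \<nu>' :: "'a::polish_space measure"
  assumes b: "0 < b"
    and \<mu>: "\<mu> \<in> finite_borel_measures" and \<nu>: "\<nu> \<in> finite_borel_measures"
    and \<mu>': "\<mu>' \<in> finite_borel_measures1" and \<nu>': "\<nu>' \<in> finite_borel_measures1"
    and eq: "measure \<mu>' UNIV = measure \<nu>' UNIV" and f: "f \<in> test_functions a b"
  shows "integral_signed_diff \<mu> \<nu> (apply_bcontfun f) \<le> a * total_variation (signed_diff \<mu> \<mu>')
    + a * total_variation (signed_diff \<nu> \<nu>') + b * wasserstein1 \<mu>' \<nu>'"
proof -
  let ?f = "apply_bcontfun f"
  have bound: "\<bar>?f x\<bar> \<le> a" and lip: "\<bar>?f x - ?f y\<bar> \<le> b * dist x y" for x y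
    using f b by (simp_all add: test_functions_iff)
  have meas: "?f \<in> borel_measurable borel" by (intro borel_measurable_continuous_onI) simp
  have fin: "\<mu>' \<in> finite_borel_measures" "\<nu>' \<in> finite_borel_measures"
    using \<mu>' \<nu>' by (auto simp: finite_borel_measures1_def)
  have "(\<integral>x. ?f x \<partial>\<mu>) - (\<integral>x. ?f x \<partial>\<mu>') \<le> a * total_variation (signed_diff \<mu> \<mu>')"
    by (rule integral_diff_le_total_variation[OF \<mu> fin(1) meas bound])
  moreover have "(\<integral>x. - ?f x \<partial>\<nu>) - (\<integral>x. - ?f x \<partial>\<nu>') \<le> a * total_variation (signed_diff \<nu> \<nu>')"
    using meas bound by (intro integral_diff_le_total_variation[OF \<nu> fin(2)]) auto
  moreover have "(\<integral>x. ?f x \<partial>\<mu>') - (\<integral>x. ?f x \<partial>\<nu>') \<le> b * wasserstein1 \<mu>' \<nu>'"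
    using lip by (intro wasserstein1_dual_bound[OF \<mu>' \<nu>' eq b bound _ meas]) (auto simp: abs_le_iff)
  ultimately show ?thesis by (simp add: integral_signed_diff_def)
qed

theorem theorem1p2:
  fixes a b :: real and \<mu> \<nu> :: "'a::polish_space measure"
  assumes "a > 0" and "b > 0"
    and "\<mu> \<in> finite_borel_measures" and "\<nu> \<in> finite_borel_measures"
  shows "gen_wasserstein a b \<mu> \<nu> =
    Sup {integral_signed_diff \<mu> \<nu> (apply_bcontfun f) |f. f \<in> test_functions a b}"
    (is "_ = Sup ?S")
proof (rule antisym)
  have zero: "(0 :: 'a \<Rightarrow>\<^sub>C real) \<in> test_functions a b"
    using assms by (simp add: test_functions_iff)
  have null: "null_measure borel \<in> finite_borel_measures1"
    by (auto simp: finite_borel_measures1_def finite_borel_measures_def intro!: finite_measureI)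
  show "Sup ?S \<le> gen_wasserstein a b \<mu> \<nu>"
  proof (rule cSup_least)
    show "?S \<noteq> {}" using zero by blast
    fix s assume "s \<in> ?S"
    then obtain f where f: "f \<in> test_functions a b" "s = integral_signed_diff \<mu> \<nu> (apply_bcontfun f)"
      by blast
    show "s \<le> gen_wasserstein a b \<mu> \<nu>"
      unfolding gen_wasserstein_def
    proof (rule cInf_greatest, goal_cases)
      case 1
      show ?case using null by blast
    next
      case (2 v)
      then show ?case
        using integral_signed_diff_le_decomposition[OF assms(2-4) _ _ _ f(1)] f(2) by blast
    qed
  qed
  have bdd: "bdd_above ?S"
  proof (rule bdd_aboveI[of _ "a * measure \<mu> UNIV + a * measure \<nu> UNIV"])
    fix s assume "s \<in> ?S"
    then obtain f where f: "f \<in> test_functions a b" "s = integral_signed_diff \<mu> \<nu> (apply_bcontfun f)"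
      by blast
    have "apply_bcontfun f \<in> borel_measurable borel" by (intro borel_measurable_continuous_onI) simp
    moreover have "\<bar>apply_bcontfun f x\<bar> \<le> a" for x using f assms by (simp add: test_functions_iff)
    ultimately show "s \<le> a * measure \<mu> UNIV + a * measure \<nu> UNIV"
      using abs_integral_le[OF assms(3), of "apply_bcontfun f" a]
        abs_integral_le[OF assms(4), of "apply_bcontfun f" a]
      by (simp add: f(2) integral_signed_diff_def abs_le_iff)
  qed
  show "gen_wasserstein a b \<mu> \<nu> \<le> Sup ?S"
  proof (rule field_le_epsilon)
    fix e :: real assume e: "0 < e"
    define C where "C = 1 + 4 * a + 3 * b * measure \<mu> UNIV + 3 * b * measure \<nu> UNIV"
    have C: "0 < C" using assms by (simp add: C_def add_pos_nonneg)
    obtain f where f: "f \<in> test_functions a b"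
      "gen_wasserstein a b \<mu> \<nu> \<le> integral_signed_diff \<mu> \<nu> (apply_bcontfun f) + e / C * C"
      using almost_optimal_test_function[OF assms, of "e / C"] e C unfolding C_def[symmetric] by auto
    moreover have "integral_signed_diff \<mu> \<nu> (apply_bcontfun f) \<le> Sup ?S"
      using f(1) by (intro cSup_upper bdd) blast
    ultimately show "gen_wasserstein a b \<mu> \<nu> \<le> Sup ?S + e" using C by simp
  qed
qed

end
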